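(* The measure $$m_1=\frac{1}{\pi}\,\delta_0\otimes\sqrt{2-x_2^2}\;\mathcal{H}^1\llcorner(-\sqrt2,\sqrt2)$$ satisfies the conditions $$(V*m_1)(x)+\frac{|x|^2}{2}=\frac12+\frac12\log 2\qquad\text{for every }x\in\operatorname{supp}m_1,$$ $$(V*m_1)(x)+\frac{|x|^2}{2}\geq\frac12+\frac12\log 2\qquad\text{for every }x\in\mathbb{R}^2,$$ and hence is the unique minimiser of $I$ on $\mathcal{P}(\mathbb{R}^2)$.
   Context: $\mathcal{P}(\mathbb{R}^2)$ denotes the class of all positive Borel measures on $\mathbb{R}^2$ with unit mass. The interaction potential $V:\mathbb{R}^2\to(-\infty,+\infty]$ is $$V(x):=-\log|x|+\frac{x_1^2}{|x|^2}\quad\text{for }x=(x_1,x_2)\neq 0,\qquad V(0):=+\infty,$$ and $(V*\mu)(x):=\int_{\mathbb{R}^2}V(x-y)\,d\mu(y)$. The energy $I:\mathcal{P}(\mathbb{R}^2)\to[0,+\infty]$ is $$I(\mu):=\iint_{\mathbb{R}^2\times\mathbb{R}^2}\Big(V(x-y)+\frac12\big(|x|^2+|y|^2\big)\Big)\,d\mu(x)\,d\mu(y),$$ which is well defined because the integrand is non-negative. It coincides with $\iint V(x-y)\,d\mu(x)\,d\mu(y)+\int|x|^2\,d\mu(x)$ whenever the first of these integrals is not $-\infty$. The measure $m_1$ is the semi-circle law on the vertical axis, i.e. the probability measure on $\mathbb{R}^2$ given by $\int f\,dm_1=\frac1\pi\int_{-\sqrt2}^{\sqrt2}f(0,x_2)\sqrt{2-x_2^2}\,dx_2$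 for bounded Borel $f$. Its support is $\{0\}\times[-\sqrt2,\sqrt2]$. Here $\mathcal{H}^1$ is the one-dimensional Hausdorff measure and $\llcorner$ denotes restriction. *)

theory Defs
  imports "HOL-Probability.Probability"
begin

text \<open>
  The plane is \<^typ>\<open>real \<times> real\<close>, whose norm in the library is the Euclidean one.
\<close>

type_synonym plane = "real \<times> real"

definition prob_measures :: "plane measure set" where
  "prob_measures = space (prob_algebra borel)"

definition V :: "plane \<Rightarrow> ereal" where
  "V x = (if x = 0 then \<infinity> else ereal (- ln (norm x) + (fst x)\<^sup>2 / (norm x)\<^sup>2))"

text \<open>
  Integral of an extended-real function, as integral of the positive part minus integral of the
  negative part. It is meaningful when one of the two is finite; otherwise it has the
  conventional value \<open>\<infinity> - \<infinity> = \<infinity>\<close> of \<^typ>\<open>ereal\<close>.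
\<close>

definition ext_integral :: "'a measure \<Rightarrow> ('a \<Rightarrow> ereal) \<Rightarrow> ereal" where
  "ext_integral M f =
     enn2ereal (\<integral>\<^sup>+ x. e2ennreal (f x) \<partial>M) - enn2ereal (\<integral>\<^sup>+ x. e2ennreal (- f x) \<partial>M)"

definition convol :: "(plane \<Rightarrow> ereal) \<Rightarrow> plane measure \<Rightarrow> plane \<Rightarrow> ereal" where
  "convol W \<mu> x = ext_integral \<mu> (\<lambda>y. W (x - y))"

definition energy_density :: "plane \<Rightarrow> plane \<Rightarrow> ereal" where
  "energy_density x y = V (x - y) + ereal (1 / 2 * ((norm x)\<^sup>2 + (norm y)\<^sup>2))"

text \<open>
  \<^const>\<open>e2ennreal\<close> sends negative values to \<open>0\<close>; by the next lemma nothing is lost in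
  the definition of the energy.
\<close>

lemma energy_density_nonneg: "0 \<le> energy_density x y"
proof (cases "x = y")
  case True
  then show ?thesis by (simp add: energy_density_def V_def)
next
  case False
  define r where "r = norm (x - y)"
  have r: "r > 0" using False by (simp add: r_def)
  have "r \<le> norm x + norm y"
    unfolding r_def by (rule norm_triangle_ineq4)
  then have "r\<^sup>2 \<le> (norm x + norm y)\<^sup>2"
    using r by (intro power_mono) auto
  moreover have "(norm x + norm y)\<^sup>2 \<le> 2 * ((norm x)\<^sup>2 + (norm y)\<^sup>2)"
    using sum_squares_bound[of "norm x" "norm y"] by (simp add: power2_sum)
  ultimately have rr: "r\<^sup>2 / 4 \<le> 1 / 2 * ((norm x)\<^sup>2 + (norm y)\<^sup>2)" by simp
  have "ln (r\<^sup>2 / 2) \<le> r\<^sup>2 / 2 - 1"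
    using r by (intro ln_le_minus_one) auto
  then have "2 * ln r \<le> r\<^sup>2 / 2 - 1 + ln 2"
    using r by (simp add: ln_div ln_realpow)
  then have "ln r \<le> r\<^sup>2 / 4" using ln_2_less_1 by simp
  with rr have "ln r \<le> 1 / 2 * ((norm x)\<^sup>2 + (norm y)\<^sup>2)" by linarith
  moreover have "0 \<le> (fst (x - y))\<^sup>2 / r\<^sup>2" by simp
  ultimately have "0 \<le> - ln r + (fst (x - y))\<^sup>2 / r\<^sup>2 + 1 / 2 * ((norm x)\<^sup>2 + (norm y)\<^sup>2)"
    by linarith
  then show ?thesis
    using False by (simp add: energy_density_def V_def r_def)
qed

definition energy :: "plane measure \<Rightarrow> ennreal" where
  "energy \<mu> = (\<integral>\<^sup>+ (x, y). e2ennreal (energy_density x y) \<partial>(\<mu> \<Otimes>\<^sub>M \<mu>))"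

text \<open>
  On a coordinate axis the one-dimensional Hausdorff measure is the Lebesgue measure
  \<^const>\<open>lborel\<close> in the corresponding coordinate.
\<close>

definition m\<^sub>1 :: "plane measure" where
  "m\<^sub>1 = return borel 0 \<Otimes>\<^sub>M
     density lborel
       (\<lambda>t. ennreal (1 / pi * sqrt (2 - t\<^sup>2)) * indicator {- sqrt 2<..<sqrt 2} t)"

text \<open>
  The convolution of \<^const>\<open>V\<close> with this measure is everywhere well defined in
  \<open>(-\<infinity>, \<infinity>]\<close>: the negative part has a finite integral.
\<close>

lemma measurable_V [measurable]: "V \<in> borel_measurable borel"
proof -
  have [measurable]: "(fst :: plane \<Rightarrow> real) \<in> borel_measurable borel"
    by (intro borel_measurable_continuous_onI continuous_intros)
  have [measurable]: "(norm :: plane \<Rightarrow> real) \<in> borel_measurable borel"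
    by (intro borel_measurable_continuous_onI continuous_intros)
  have [measurable]: "Measurable.pred borel (\<lambda>x :: plane. x = 0)"
    by (simp add: pred_def)
  show ?thesis unfolding V_def by measurable
qed

lemma V_m1_negative_part_finite: "(\<integral>\<^sup>+ y. e2ennreal (- V (x - y)) \<partial>m\<^sub>1) < \<infinity>"
proof -
  define f where
    "f = (\<lambda>t. ennreal (1 / pi * sqrt (2 - t\<^sup>2)) * indicator {- sqrt 2<..<sqrt 2} t)"
  define D where "D = density lborel f"
  have fm [measurable]: "f \<in> borel_measurable borel" unfolding f_def by measurable
  define C where "C = norm x + sqrt 2"
  have fle: "f t \<le> ennreal (sqrt 2) * indicator {- sqrt 2<..<sqrt 2} t" for t
  proof -
    have "1 / pi * sqrt (2 - t\<^sup>2) \<le> 1 * sqrt 2" if "t \<in> {- sqrt 2<..<sqrt 2}"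
    proof (rule mult_mono)
      have "1 \<le> pi" using pi_ge_two by linarith
      then show "1 / pi \<le> 1" by simp
      have "\<bar>t\<bar> \<le> sqrt 2" using that by auto
      then have "t\<^sup>2 \<le> 2" using power_mono[of "\<bar>t\<bar>" "sqrt 2" 2] by simp
      then show "0 \<le> sqrt (2 - t\<^sup>2)" by simp
    qed auto
    then show ?thesis by (auto simp: f_def indicator_def intro!: ennreal_leI)
  qed
  have Vle: "e2ennreal (- V (x - (0, t))) \<le> ennreal C" if "t \<in> {- sqrt 2<..<sqrt 2}" for t
  proof (cases "x - (0, t) = 0")
    case True
    then show ?thesis by (simp add: V_def e2ennreal_neg)
  next
    case False
    let ?z = "x - (0, t)"
    have "ln (norm ?z) \<le> norm ?z - 1" using False by (intro ln_le_minus_one) simp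
    moreover have "norm ?z \<le> norm x + norm (0 :: real, t)" by (rule norm_triangle_ineq4)
    moreover have "norm (0 :: real, t) \<le> sqrt 2" using that by (auto simp: norm_Pair)
    moreover have "0 \<le> (fst ?z)\<^sup>2 / (norm ?z)\<^sup>2" by simp
    ultimately have "ln (norm ?z) - (fst ?z)\<^sup>2 / (norm ?z)\<^sup>2 \<le> C" unfolding C_def by linarith
    then show ?thesis using False by (simp add: V_def ennreal_leI)
  qed
  have D: "sigma_finite_measure D" unfolding D_def
    by (subst sigma_finite_measure.sigma_finite_iff_density_finite[OF lborel.sigma_finite_measure_axioms]) (auto simp: f_def indicator_def)
  interpret D: sigma_finite_measure D by fact
  have [measurable_cong]: "sets D = sets borel" by (simp add: D_def)
  let ?g = "\<lambda>y. e2ennreal (- V (x - y))"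
  have [measurable]: "?g \<in> borel_measurable (return borel 0 \<Otimes>\<^sub>M D)"
  proof -
    have "sets (return borel 0 \<Otimes>\<^sub>M D) = sets (borel \<Otimes>\<^sub>M borel :: plane measure)"
      by (intro sets_pair_measure_cong) (simp_all add: D_def)
    then have eq: "sets (return borel 0 \<Otimes>\<^sub>M D) = sets (borel :: plane measure)"
      by (simp only: borel_prod)
    have "?g \<in> borel_measurable borel" by measurable
    then show ?thesis by (simp only: measurable_cong_sets[OF eq refl])
  qed
  have [measurable]: "(\<lambda>t. ?g (0, t)) \<in> borel_measurable borel"
  proof -
    have "(\<lambda>t :: real. (0 :: real, t)) \<in> borel \<rightarrow>\<^sub>M borel"
      by (intro borel_measurable_continuous_onI continuous_intros)
    then show ?thesis by measurable
  qed
  have "(\<integral>\<^sup>+ y. ?g y \<partial>m\<^sub>1) = (\<integral>\<^sup>+ a. \<integral>\<^sup>+ t. ?g (a, t) \<partial>D \<partial>return borel 0)"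
    unfolding m\<^sub>1_def f_def[symmetric] D_def[symmetric]
    by (rule D.nn_integral_fst[symmetric]) measurable
  also have "\<dots> = (\<integral>\<^sup>+ t. ?g (0, t) \<partial>D)"
    by (rule nn_integral_return) auto
  also have "\<dots> = (\<integral>\<^sup>+ t. f t * ?g (0, t) \<partial>lborel)"
    unfolding D_def by (rule nn_integral_density) auto
  also have "\<dots> \<le> (\<integral>\<^sup>+ t. ennreal (sqrt 2) * ennreal C * indicator {- sqrt 2<..<sqrt 2} t \<partial>lborel)"
  proof (rule nn_integral_mono)
    fix t
    show "f t * ?g (0, t) \<le> ennreal (sqrt 2) * ennreal C * indicator {- sqrt 2<..<sqrt 2} t"
      using mult_mono[OF fle[of t] Vle[of t]] fle[of t]
      by (cases "t \<in> {- sqrt 2<..<sqrt 2}") auto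
  qed
  also have "\<dots> = ennreal (sqrt 2) * ennreal C * emeasure lborel {- sqrt 2<..<sqrt 2}"
    by (rule nn_integral_cmult_indicator) simp
  also have "\<dots> < \<infinity>"
    by (simp add: ennreal_mult_less_top)
  finally show ?thesis .
qed

definition supp :: "'a::topological_space measure \<Rightarrow> 'a set" where
  "supp \<mu> = {x. \<forall>U. open U \<longrightarrow> x \<in> U \<longrightarrow> emeasure \<mu> U > 0}"

end

theory Submission
  imports Defs
begin

text \<open>
  The theorem is the mean, over a one-parameter family of projections of the plane onto the line,
  of one statement about the logarithmic energy on the line.

  Let an angle \<open>\<theta>\<close> be distributed on \<open>(0, \<pi>)\<close> with density \<open>(2 / \<pi>) sin\<^sup>2 \<theta>\<close>, and put
  \<open>p\<^sub>\<theta>(x) = x\<^sub>2 + x\<^sub>1 cot \<theta>\<close> (\<open>shear\<close>) and \<open>K(s, t) = - ln |s - t| + (s\<^sup>2 + t\<^sup>2) / 2\<close> (\<open>log_kernel\<close>).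
  Then \<open>V(x - y) + (|x|\<^sup>2 + |y|\<^sup>2) / 2\<close> is exactly the mean of \<open>K(p\<^sub>\<theta> x, p\<^sub>\<theta> y)\<close> over \<open>\<theta>\<close>
  (\<open>energy_density_mixture\<close>). The reason is that away from the origin the Fourier transform of
  \<open>V\<close> is a positive multiple of \<open>\<xi>\<^sub>2\<^sup>2 / |\<xi>|\<^sup>4\<close>, which is nonnegative and homogeneous of degree \<open>-2\<close>; so \<open>V\<close> is a
  superposition, with nonnegative weights, of logarithmic kernels of one linear coordinate, and the
  anisotropy of \<open>V\<close> is the weight \<open>sin\<^sup>2 \<theta>\<close>. The identity itself only needs a few Fourier
  coefficients of \<open>ln |2 sin u|\<close>, and that the slopes \<open>cot \<theta>\<close> average the squares
  \<open>p\<^sub>\<theta>(x)\<^sup>2\<close> to \<open>|x|\<^sup>2\<close>. As \<open>K \<ge> 0\<close>, Tonelli's theorem turns the energy of a probability measure \<open>\<mu>\<close>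
  into the mean of the one-dimensional energies of its images \<open>p\<^sub>\<theta>#\<mu>\<close> (\<open>energy_mixture\<close>).

  Every \<open>p\<^sub>\<theta>\<close> sends \<open>(0, t)\<close> to \<open>t\<close>, so the image of \<^const>\<open>m\<^sub>1\<close> is the
  semicircle law \<open>\<sigma>\<close> of radius \<open>\<surd>2\<close> for every \<open>\<theta>\<close> at once. It remains to know three things about \<open>\<sigma>\<close>.

  \<^item> The potential \<open>\<integral>K(s, t) d\<sigma>(t)\<close> equals \<open>3/4 + (ln 2)/2\<close> for \<open>|s| \<le> \<surd>2\<close> and is at least this
    number for all \<open>s\<close> (\<open>semicircle_potential_inside\<close>, \<open>semicircle_potential_outside\<close>). The mean over
    \<open>\<theta>\<close> gives the two conditions on \<open>V * m\<^sub>1\<close>: the potential of the energy density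
    exceeds \<open>(V * m\<^sub>1)(x) + |x|\<^sup>2 / 2\<close> by \<open>1/4\<close>, half of the second moment of \<open>\<sigma>\<close>.

  \<^item> The logarithmic kernel is positive definite on differences of probability measures: writing \<open>E\<close> for the
    energy on the line, \<open>D(\<nu>, \<rho>) + 2 E(\<nu>, \<rho>) \<le> E(\<nu>, \<nu>) + E(\<rho>, \<rho>)\<close>, where \<open>D\<close> is a weighted square
    distance between the masses that \<open>\<nu>\<close> and \<open>\<rho>\<close> give to short intervals (\<open>log_energy_inequality\<close>).
    With \<open>\<rho> = \<sigma>\<close> and the lower bound for the potential, \<open>D(\<nu>, \<sigma>) + 3/4 + (ln 2)/2 \<le> E(\<nu>, \<nu>)\<close>.
    So \<open>\<sigma>\<close> minimises \<open>E\<close>, hence \<^const>\<open>m\<^sub>1\<close> minimises the planar energy.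

  \<^item> \<open>D(\<nu>, \<sigma>) = 0\<close> forces \<open>\<nu> = \<sigma>\<close>. Hence a planar minimiser \<open>\<mu>\<close> satisfies \<open>p\<^sub>\<theta>#\<mu> = \<sigma>\<close> for almost every
    \<open>\<theta>\<close>. Then \<open>|x\<^sub>2 + x\<^sub>1 cot \<theta>| \<le> \<surd>2\<close> almost surely along angles tending to \<open>0\<close>, where
    \<open>cot \<theta>\<close> is unbounded, so \<open>\<mu>\<close> lives on the axis \<open>x\<^sub>1 = 0\<close>. There a single projection determines \<open>\<mu>\<close>
    (\<open>eq_m1_if_shears_semicircle\<close>).
\<close>

section \<open>Fourier coefficients of the logarithm of the sine\<close>

definition logsin :: "real \<Rightarrow> real" where
  "logsin u = ln \<bar>2 * sin u\<bar>"

lemma logsin_periodic: "logsin (u + pi) = logsin u"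
  by (simp add: logsin_def)

lemma logsin_minus: "logsin (- u) = logsin u"
  by (simp add: logsin_def)

text \<open>
  The zeros of the sine absorb the logarithmic singularities. This is what lets the fundamental
  theorem of calculus run across them in what follows.
\<close>

lemma continuous_sin_logsin: "continuous_on UNIV (\<lambda>u. sin u * logsin u)"
proof -
  have at0: "isCont (\<lambda>y::real. y * ln \<bar>2 * y\<bar>) y" for y
  proof (cases "y = 0")
    case True
    have "((\<lambda>y::real. y * ln \<bar>2 * y\<bar>) \<longlongrightarrow> 0) (at_right 0)"
      by real_asymp
    moreover have "((\<lambda>y::real. y * ln \<bar>2 * y\<bar>) \<longlongrightarrow> 0) (at_left 0)"
      by real_asymp
    ultimately show ?thesis
      using True by (simp add: isCont_def filterlim_split_at)
  next
    case False
    then show ?thesis by (intro continuous_intros) auto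
  qed
  have "continuous_on UNIV (\<lambda>y::real. y * ln \<bar>2 * y\<bar>)"
    using at0 by (simp add: continuous_on_eq_continuous_at)
  from continuous_on_compose2[OF this continuous_on_sin[OF continuous_on_id]]
  show ?thesis by (simp add: logsin_def)
qed

lemma finite_sin_zeros: fixes a b :: real shows "finite {u \<in> {a..b}. sin u = 0}"
proof -
  have "{u \<in> {a..b}. sin u = 0} \<subseteq> (\<lambda>i. of_int i * pi) ` {\<lfloor>a / pi\<rfloor>..\<lceil>b / pi\<rceil>}"
  proof
    fix u assume u: "u \<in> {u \<in> {a..b}. sin u = 0}"
    then obtain i :: int where i: "u = of_int i * pi"
      using sin_zero_iff_int2 by auto
    have "a / pi \<le> of_int i" "of_int i \<le> b / pi"
      using u i by (auto simp: field_simps)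
    then have "i \<in> {\<lfloor>a / pi\<rfloor>..\<lceil>b / pi\<rceil>}"
      by (auto simp: floor_le_iff le_ceiling_iff)
    with i show "u \<in> (\<lambda>i. of_int i * pi) ` {\<lfloor>a / pi\<rfloor>..\<lceil>b / pi\<rceil>}"
      by auto
  qed
  then show ?thesis by (rule finite_subset) simp
qed

lemma logsin_derivative:
  assumes "sin u \<noteq> 0"
  shows "(logsin has_real_derivative cos u / sin u) (at u)"
proof -
  have eq: "logsin = (\<lambda>u. ln ((2 * sin u)\<^sup>2) / 2)"
  proof
    fix u
    show "logsin u = ln ((2 * sin u)\<^sup>2) / 2"
      using ln_realpow[of "\<bar>2 * sin u\<bar>" 2] by (cases "sin u = 0") (simp_all add: logsin_def)
  qed
  show ?thesis
    unfolding eq using assms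
    by (auto intro!: derivative_eq_intros simp: power2_eq_square field_simps zero_less_mult_iff)
qed

text \<open>
  All the antiderivatives that are needed have the form \<open>r sin logsin + g\<close> with smooth \<open>r\<close> and \<open>g\<close>: a
  continuous function that is differentiable off the finitely many zeros of the sine.
\<close>

lemma has_integral_via_logsin:
  assumes ab: "a \<le> b"
    and r: "continuous_on UNIV r" "continuous_on UNIV g"
    and g': "\<And>u. (g has_real_derivative g' u) (at u)"
    and r': "\<And>u. (r has_real_derivative r' u) (at u)"
    and F: "\<And>u. sin u \<noteq> 0 \<Longrightarrow>
      f u = (r' u * sin u + r u * cos u) * logsin u + r u * cos u + g' u"
  shows "(f has_integral
    (r b * sin b * logsin b + g b - (r a * sin a * logsin a + g a))) {a..b}"
proof (rule fundamental_theorem_of_calculus_interior_strong[OF finite_sin_zeros[of a b] ab])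
  fix u assume "u \<in> {a<..<b} - {u \<in> {a..b}. sin u = 0}"
  then have u: "sin u \<noteq> 0" by auto
  have "((\<lambda>u. r u * sin u * logsin u + g u) has_real_derivative f u) (at u)"
    unfolding F[OF u]
    by (rule derivative_eq_intros r' g' logsin_derivative[OF u] refl)+ (use u in \<open>simp add: field_simps\<close>)
  then show "((\<lambda>u. r u * sin u * logsin u + g u) has_vector_derivative f u) (at u)"
    by (simp add: has_real_derivative_iff_has_vector_derivative)
next
  have "continuous_on {a..b} (\<lambda>u. r u * (sin u * logsin u) + g u)"
    by (intro continuous_intros continuous_on_subset[OF continuous_sin_logsin]
        continuous_on_subset[OF r(1)] continuous_on_subset[OF r(2)]) auto
  then show "continuous_on {a..b} (\<lambda>u. r u * sin u * logsin u + g u)"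
    by (simp add: mult.assoc)
qed

lemma sin_cos_quadruple: fixes u :: real
  shows "sin (4 * u) = 4 * sin u * cos u * (2 * (cos u)\<^sup>2 - 1)"
    "cos (4 * u) = 8 * (cos u)^4 - 8 * (cos u)\<^sup>2 + 1"
proof -
  have 4: "4 * u = 2 * (2 * u)" by simp
  show "sin (4 * u) = 4 * sin u * cos u * (2 * (cos u)\<^sup>2 - 1)"
    unfolding 4 sin_double[of "2*u"] sin_double[of u] cos_double_cos[of u] by simp
  show "cos (4 * u) = 8 * (cos u)^4 - 8 * (cos u)\<^sup>2 + 1"
    unfolding 4 cos_double_cos[of "2*u"] cos_double_cos[of u]
    by (simp add: power2_eq_square power4_eq_xxxx algebra_simps)
qed

lemma continuous_on_of_DERIV: "(\<And>u::real. (g has_real_derivative g' u) (at u)) \<Longrightarrow> continuous_on UNIV g"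
  by (meson DERIV_isCont continuous_at_imp_continuous_on)

lemma logsin_cos2_primitive:
  assumes "a \<le> b"
  shows "((\<lambda>u. cos (2 * u) * logsin u) has_integral
    (cos b * sin b * logsin b + (- b / 2 - sin (2 * b) / 4)
      - (cos a * sin a * logsin a + (- a / 2 - sin (2 * a) / 4)))) {a..b}"
proof -
  have d1: "((\<lambda>u. - u / 2 - sin (2 * u) / 4) has_real_derivative - 1 / 2 - cos (2 * u) / 2) (at u)" for u :: real
    by (auto intro!: derivative_eq_intros)
  have d2: "(cos has_real_derivative - sin u) (at u)" for u :: real
    by (rule DERIV_cos)
  show ?thesis
  proof (rule has_integral_via_logsin[OF assms continuous_on_of_DERIV[OF d2] continuous_on_of_DERIV[OF d1] d1 d2])
    fix u :: real
    show "cos (2 * u) * logsin u = (- sin u * sin u + cos u * cos u) * logsin u + cos u * cos u +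
        (- 1 / 2 - cos (2 * u) / 2)"
      unfolding cos_double_cos by (simp add: sin_squared_eq power2_eq_square[symmetric] field_simps)
  qed
qed

lemma logsin_cos2_period:
  "((\<lambda>u. cos (2 * u) * logsin u) has_integral - pi / 2) {a..a + pi}"
  using logsin_cos2_primitive[of a "a + pi"]
  by (simp add: logsin_periodic distrib_left diff_divide_distrib)

lemma logsin_sin2_period:
  "((\<lambda>u. sin (2 * u) * logsin u) has_integral 0) {a..a + pi}"
proof -
  have d1: "((\<lambda>u. - (sin u)\<^sup>2 / 2) has_real_derivative - sin u * cos u) (at u)" for u :: real
    by (auto intro!: derivative_eq_intros)
  have d2: "(sin has_real_derivative cos u) (at u)" for u :: real
    by (rule DERIV_sin)
  have "((\<lambda>u. sin (2 * u) * logsin u) has_integral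
    (sin (a + pi) * sin (a + pi) * logsin (a + pi) + - (sin (a + pi))\<^sup>2 / 2
      - (sin a * sin a * logsin a + - (sin a)\<^sup>2 / 2))) {a..a + pi}"
    by (rule has_integral_via_logsin[OF _ continuous_on_of_DERIV[OF d2] continuous_on_of_DERIV[OF d1] d1 d2])
      (simp_all add: sin_double)
  then show ?thesis by (simp add: logsin_periodic)
qed

lemma logsin_cos4_period:
  "((\<lambda>u. cos (4 * u) * logsin u) has_integral - pi / 4) {a..a + pi}"
proof -
  have d1: "((\<lambda>u. - u / 4 - sin (2 * u) / 4 - sin (4 * u) / 16) has_real_derivative
      - 1 / 4 - cos (2 * u) / 2 - cos (4 * u) / 4) (at u)" for u :: real
    by (auto intro!: derivative_eq_intros)
  have d2: "((\<lambda>u. cos u * cos (2 * u)) has_real_derivative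
      - sin u * cos (2 * u) - 2 * cos u * sin (2 * u)) (at u)" for u :: real
    by (auto intro!: derivative_eq_intros)
  have "((\<lambda>u. cos (4 * u) * logsin u) has_integral
    (cos (a + pi) * cos (2 * (a + pi)) * sin (a + pi) * logsin (a + pi)
        + (- (a + pi) / 4 - sin (2 * (a + pi)) / 4 - sin (4 * (a + pi)) / 16)
      - (cos a * cos (2 * a) * sin a * logsin a
        + (- a / 4 - sin (2 * a) / 4 - sin (4 * a) / 16)))) {a..a + pi}"
  proof (rule has_integral_via_logsin[OF _ continuous_on_of_DERIV[OF d2] continuous_on_of_DERIV[OF d1] d1 d2])
    fix u :: real
    define c where "c = cos u"
    have s: "sin u * sin u = 1 - c * c"
      using sin_squared_eq[of u] by (simp add: power2_eq_square c_def)
    have 1: "(- sin u * cos (2 * u) - 2 * cos u * sin (2 * u)) * sin u + cos u * cos (2 * u) * cos u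
      = cos (4 * u)"
    proof -
      have "(- sin u * cos (2 * u) - 2 * cos u * sin (2 * u)) * sin u + cos u * cos (2 * u) * cos u
        = - (sin u * sin u) * (2 * c\<^sup>2 - 1) - 4 * c * c * (sin u * sin u) + c * c * (2 * c\<^sup>2 - 1)"
        unfolding cos_double_cos sin_double c_def by (simp add: algebra_simps)
      also have "\<dots> = cos (4 * u)"
        unfolding s sin_cos_quadruple c_def[symmetric]
        by (simp add: power2_eq_square power4_eq_xxxx algebra_simps)
      finally show ?thesis .
    qed
    have 2: "cos u * cos (2 * u) * cos u + (- 1 / 4 - cos (2 * u) / 2 - cos (4 * u) / 4) = 0"
      unfolding cos_double_cos sin_cos_quadruple
      by (simp add: power2_eq_square power4_eq_xxxx field_simps)
    show "cos (4 * u) * logsin u =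
       ((- sin u * cos (2 * u) - 2 * cos u * sin (2 * u)) * sin u + cos u * cos (2 * u) * cos u) *
       logsin u + cos u * cos (2 * u) * cos u + (- 1 / 4 - cos (2 * u) / 2 - cos (4 * u) / 4)"
      unfolding 1 using 2 by simp
  qed simp
  moreover have "sin (4 * (a + pi)) = sin (4 * a)" "cos (2 * (a + pi)) = cos (2 * a)"
    "sin (2 * (a + pi)) = sin (2 * a)"
    unfolding sin_cos_quadruple by (simp_all add: distrib_left)
  ultimately show ?thesis by (simp add: logsin_periodic diff_divide_distrib)
qed

lemma logsin_sin4_period:
  "((\<lambda>u. sin (4 * u) * logsin u) has_integral 0) {a..a + pi}"
proof -
  have d1: "((\<lambda>u. (cos u) ^ 4 / 2) has_real_derivative - 2 * (cos u) ^ 3 * sin u) (at u)" for u :: real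
    by (auto intro!: derivative_eq_intros)
  have d2: "((\<lambda>u. 2 * sin u * (cos u)\<^sup>2) has_real_derivative
      2 * (cos u) ^ 3 - 4 * (sin u)\<^sup>2 * cos u) (at u)" for u :: real
    by (auto intro!: derivative_eq_intros simp: power2_eq_square power3_eq_cube)
  have "((\<lambda>u. sin (4 * u) * logsin u) has_integral
    (2 * sin (a + pi) * (cos (a + pi))\<^sup>2 * sin (a + pi) * logsin (a + pi) + (cos (a + pi)) ^ 4 / 2
      - (2 * sin a * (cos a)\<^sup>2 * sin a * logsin a + (cos a) ^ 4 / 2))) {a..a + pi}"
  proof (rule has_integral_via_logsin[OF _ continuous_on_of_DERIV[OF d2] continuous_on_of_DERIV[OF d1] d1 d2])
    fix u :: real
    have "(2 * (cos u) ^ 3 - 4 * (sin u)\<^sup>2 * cos u) * sin u + 2 * sin u * (cos u)\<^sup>2 * cos u = sin (4 * u)"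
      unfolding sin_cos_quadruple sin_squared_eq
      by (simp add: power2_eq_square power3_eq_cube algebra_simps)
    then show "sin (4 * u) * logsin u =
       ((2 * (cos u) ^ 3 - 4 * (sin u)\<^sup>2 * cos u) * sin u + 2 * sin u * (cos u)\<^sup>2 * cos u) *
       logsin u + 2 * sin u * (cos u)\<^sup>2 * cos u + - 2 * (cos u) ^ 3 * sin u"
      by (simp add: power2_eq_square power3_eq_cube)
  qed simp
  then show ?thesis by (simp add: logsin_periodic)
qed

text \<open>
  Multiplying by \<open>1 = cos 2u + 2 sin\<^sup>2 u\<close> splits \<^const>\<open>logsin\<close> into a function with an
  explicit antiderivative and a continuous one.
\<close>

lemma logsin_integrable: "logsin integrable_on {a..b}"
proof (cases "a \<le> b")
  case True
  have "(\<lambda>u. cos (2 * u) * logsin u) integrable_on {a..b}"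
    using logsin_cos2_primitive[OF True] by blast
  moreover have "(\<lambda>u. 2 * sin u * (sin u * logsin u)) integrable_on {a..b}"
    by (intro integrable_continuous_real continuous_intros
        continuous_on_subset[OF continuous_sin_logsin]) auto
  ultimately have "(\<lambda>u. cos (2 * u) * logsin u + 2 * sin u * (sin u * logsin u)) integrable_on {a..b}"
    by (rule integrable_add)
  moreover have "cos (2 * u) * logsin u + 2 * sin u * (sin u * logsin u) = logsin u" for u
    unfolding cos_double_sin by (simp add: power2_eq_square algebra_simps)
  ultimately show ?thesis by simp
qed (simp add: integrable_on_empty)

lemma integral_period_shift:
  fixes f :: "real \<Rightarrow> real"
  assumes int: "\<And>a b. f integrable_on {a..b}" and per: "\<And>x. f (x + p) = f x" and p: "p \<ge> 0"
  shows "integral {a..a + p} f = integral {b..b + p} f"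
proof -
  have le: "integral {a..a + p} f = integral {b..b + p} f" if ab: "a \<le> b" for a b
  proof -
    have "integral {a..a + p} f + integral {a + p..b + p} f = integral {a..b + p} f"
      by (rule Henstock_Kurzweil_Integration.integral_combine) (use ab p int in auto)
    moreover have "integral {a..b} f + integral {b..b + p} f = integral {a..b + p} f"
      by (rule Henstock_Kurzweil_Integration.integral_combine) (use ab p int in auto)
    moreover have "integral {a + p..b + p} f = integral {a..b} f"
      using integral_shift_Icc_real[of a b f p] per by (simp add: o_def add.commute)
    ultimately show ?thesis by simp
  qed
  show ?thesis using le[of a b] le[of b a] by linarith
qed

text \<open>
  Euler's duplication argument: \<open>2 sin 2u = (2 sin u) (2 sin (u + \<pi>/2))\<close> gives
  \<open>logsin (2u) = logsin u + logsin (u + \<pi>/2)\<close>, and the integral \<open>A\<close> over a period satisfies \<open>A = A + A\<close>.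
\<close>

lemma logsin_period: "(logsin has_integral 0) {a..a + pi}"
proof -
  define A where "A = integral {0..pi} logsin"
  have A: "(logsin has_integral A) {a..a + pi}" for a
    using integral_period_shift[of logsin pi a 0, OF logsin_integrable logsin_periodic]
      logsin_integrable[of a "a + pi"]
    by (simp add: A_def has_integral_integrable_integral)
  have "(logsin has_integral (A + A)) {0..2 * pi}"
    by (rule has_integral_combine[of 0 pi]) (use A[of 0] A[of pi] in simp_all)
  from has_integral_affinity'[of logsin "A + A" 0 "2 * pi" 2 0] this
  have 1: "((\<lambda>u. logsin (2 * u)) has_integral A) {0..pi}"
    by simp
  have "((\<lambda>u. logsin u + logsin (u + pi / 2)) has_integral (A + A)) {0..pi}"
  proof (rule has_integral_add)
    show "(logsin has_integral A) {0..pi}" using A[of 0] by simp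
    show "((\<lambda>u. logsin (u + pi / 2)) has_integral A) {0..pi}"
      using A[of "pi / 2"] has_integral_shift_Icc_real[of logsin "pi / 2" A 0 pi]
      by (simp add: o_def add.commute)
  qed
  then have "((\<lambda>u. logsin (2 * u)) has_integral (A + A)) {0..pi}"
  proof (rule has_integral_spike_finite[rotated 2])
    have "finite ((\<lambda>x. x / 2) ` {u \<in> {0..2 * pi}. sin u = 0})"
      by (intro finite_imageI finite_sin_zeros)
    moreover have "{u \<in> {0..pi}. sin (2 * u) = 0} \<subseteq> (\<lambda>x. x / 2) ` {u \<in> {0..2 * pi}. sin u = 0}"
    proof
      fix u assume "u \<in> {u \<in> {0..pi}. sin (2 * u) = 0}"
      then show "u \<in> (\<lambda>x. x / 2) ` {u \<in> {0..2 * pi}. sin u = 0}"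
        by (intro image_eqI[of _ _ "2 * u"]) auto
    qed
    ultimately show "finite {u \<in> {0..pi}. sin (2 * u) = 0}" by (rule finite_subset[rotated])
    fix u :: real assume "u \<in> {0..pi} - {u \<in> {0..pi}. sin (2 * u) = 0}"
    then have "sin u \<noteq> 0" "cos u \<noteq> 0" by (auto simp: sin_double)
    then show "logsin (2 * u) = logsin u + logsin (u + pi / 2)"
      using ln_mult[of 2 "2 :: real"] by (simp add: logsin_def sin_double sin_add abs_mult ln_mult)
  qed
  with 1 have "A = A + A" by (rule has_integral_unique)
  then show ?thesis using A[of a] by simp
qed

section \<open>Positive definiteness of the logarithmic kernel\<close>

text \<open>
  The quadratic terms make the kernel nonnegative, so that its integrals exist in \<^typ>\<open>ennreal\<close>
  for all measures.
\<close>

definition log_kernel :: "real \<Rightarrow> real \<Rightarrow> ennreal" where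
  "log_kernel s t = (if s = t then \<infinity> else ennreal (- ln \<bar>s - t\<bar> + (s\<^sup>2 + t\<^sup>2) / 2))"

definition log_energy :: "real measure \<Rightarrow> real measure \<Rightarrow> ennreal" where
  "log_energy \<nu> \<rho> = (\<integral>\<^sup>+ s. \<integral>\<^sup>+ t. log_kernel s t \<partial>\<rho> \<partial>\<nu>)"

lemma log_kernel_measurable [measurable (raw)]:
  assumes [measurable]: "f \<in> borel_measurable M" "g \<in> borel_measurable M"
  shows "(\<lambda>x. log_kernel (f x) (g x)) \<in> borel_measurable M"
  unfolding log_kernel_def by measurable

lemma abs_diff_square_le: "(\<bar>s - t\<bar>)\<^sup>2 / 4 \<le> (s\<^sup>2 + t\<^sup>2) / (2 :: real)"
  using zero_le_power2[of "s + t"] by (simp add: power2_eq_square algebra_simps)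

text \<open>
  Measures of finite logarithmic energy have \<open>|s - t|\<close> integrable; this controls the error of the
  approximation by windows below.
\<close>

lemma log_kernel_bound:
  fixes s t :: real
  assumes "s \<noteq> t"
  shows "\<bar>s - t\<bar> \<le> - ln \<bar>s - t\<bar> + (s\<^sup>2 + t\<^sup>2) / 2 + 3"
proof -
  define r where "r = \<bar>s - t\<bar>"
  have "ln r \<le> r - 1" using assms by (intro ln_le_minus_one) (simp add: r_def)
  moreover have "2 * r - 4 \<le> r\<^sup>2 / 4"
    using zero_le_power2[of "r / 2 - 2"] by (simp add: power2_eq_square field_simps)
  moreover have "r\<^sup>2 / 4 \<le> (s\<^sup>2 + t\<^sup>2) / 2" unfolding r_def by (rule abs_diff_square_le)
  ultimately show ?thesis unfolding r_def[symmetric] by linarith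
qed

lemma log_kernel_nonneg:
  fixes s t :: real
  assumes "s \<noteq> t"
  shows "0 \<le> - ln \<bar>s - t\<bar> + (s\<^sup>2 + t\<^sup>2) / 2"
proof -
  define r where "r = \<bar>s - t\<bar>"
  have r: "r > 0" using assms by (simp add: r_def)
  have "ln (r\<^sup>2 / 2) \<le> r\<^sup>2 / 2 - 1" using r by (intro ln_le_minus_one) auto
  then have "ln r \<le> r\<^sup>2 / 4" using r ln_2_less_1 by (simp add: ln_div ln_realpow)
  moreover have "r\<^sup>2 / 4 \<le> (s\<^sup>2 + t\<^sup>2) / 2" unfolding r_def by (rule abs_diff_square_le)
  ultimately show ?thesis unfolding r_def[symmetric] by linarith
qed

text \<open>
  Logarithms from overlaps of intervals: if \<open>s\<close> and \<open>t\<close> are at distance \<open>r < n\<close>, the windows \<open>(u, u + h]\<close>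
  containing both form a set of \<open>u\<close> of length \<open>(h - r)\<^sup>+\<close>, and the integral of \<open>(h - r)\<^sup>+ / h\<^sup>2\<close> over
  \<open>0 < h < n\<close> is \<open>- ln r + ln n - 1 + r / n\<close>. Up to a constant and a small error, this is the logarithmic
  kernel; and a kernel that counts common windows is visibly positive definite. A window is encoded
  by the pair \<open>p = (h, u)\<close>.
\<close>

definition weight :: "real \<Rightarrow> real \<Rightarrow> ennreal" where
  "weight n h = ennreal (1 / h\<^sup>2) * indicator {0<..<n} h"

definition window :: "real \<Rightarrow> real \<times> real \<Rightarrow> ennreal" where
  "window s p = indicator {snd p<..snd p + fst p} s"

definition window_kernel :: "real \<Rightarrow> real \<Rightarrow> real \<Rightarrow> ennreal" where
  "window_kernel n s t =
    (\<integral>\<^sup>+ p. weight n (fst p) * (window s p * window t p) \<partial>(lborel \<Otimes>\<^sub>M lborel))"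

lemma weight_measurable [measurable (raw)]:
  assumes [measurable]: "f \<in> borel_measurable M"
  shows "(\<lambda>x. weight n (f x)) \<in> borel_measurable M"
  unfolding weight_def by measurable

lemma window_measurable [measurable]:
  "(\<lambda>x. window (fst x) (snd x)) \<in> borel_measurable (borel \<Otimes>\<^sub>M (lborel \<Otimes>\<^sub>M lborel))"
  unfolding window_def indicator_def greaterThanAtMost_iff by measurable

lemma window_measurable' [measurable]: "window s \<in> borel_measurable (lborel \<Otimes>\<^sub>M lborel)"
  unfolding window_def indicator_def greaterThanAtMost_iff by measurable

lemma window_kernel_eq:
  "window_kernel n s t =
    (\<integral>\<^sup>+ h. ennreal ((h - \<bar>s - t\<bar>) / h\<^sup>2) * indicator {0<..<n} h \<partial>lborel)"
proof -
  have "window_kernel n s t =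
      (\<integral>\<^sup>+ h. \<integral>\<^sup>+ u. weight n h * (window s (h, u) * window t (h, u)) \<partial>lborel \<partial>lborel)"
    unfolding window_kernel_def
    by (subst lborel.nn_integral_fst[symmetric]) auto
  also have "\<dots> = (\<integral>\<^sup>+ h. ennreal ((h - \<bar>s - t\<bar>) / h\<^sup>2) * indicator {0<..<n} h \<partial>lborel)"
  proof (rule nn_integral_cong)
    fix h :: real
    have eq: "window s (h, u) * window t (h, u) = indicator {max s t - h..<min s t} u" for u
      by (auto simp: window_def indicator_def)
    have "(\<integral>\<^sup>+ u. weight n h * (window s (h, u) * window t (h, u)) \<partial>lborel)
        = weight n h * emeasure lborel {max s t - h..<min s t}"
      unfolding eq by (rule nn_integral_cmult_indicator) simp
    also have "emeasure lborel {max s t - h..<min s t} = ennreal (h - \<bar>s - t\<bar>)"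
      by (cases "max s t - h \<le> min s t") (auto simp: ennreal_neg)
    also have "weight n h * ennreal (h - \<bar>s - t\<bar>)
        = ennreal ((h - \<bar>s - t\<bar>) / h\<^sup>2) * indicator {0<..<n} h"
      by (auto simp: weight_def indicator_def simp flip: ennreal_mult')
    finally show "(\<integral>\<^sup>+ u. weight n h * (window s (h, u) * window t (h, u)) \<partial>lborel)
        = ennreal ((h - \<bar>s - t\<bar>) / h\<^sup>2) * indicator {0<..<n} h" .
  qed
  finally show ?thesis .
qed

lemma window_kernel_near:
  assumes r: "0 < \<bar>s - t\<bar>" "\<bar>s - t\<bar> < n"
  shows "window_kernel n s t = ennreal (ln n - ln \<bar>s - t\<bar> - 1 + \<bar>s - t\<bar> / n)"
proof -
  define r where "r = \<bar>s - t\<bar>"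
  have r: "0 < r" "r < n" using assms by (auto simp: r_def)
  have "(\<integral>\<^sup>+ h. ennreal ((h - r) / h\<^sup>2) * indicator {0<..<n} h \<partial>lborel)
    = (\<integral>\<^sup>+ h. ennreal ((h - r) / h\<^sup>2) * indicator {r..n} h \<partial>lborel)"
  proof (rule nn_integral_cong_AE)
    have "AE h in lborel. h \<noteq> n" by (rule AE_lborel_singleton)
    then show "AE h in lborel. ennreal ((h - r) / h\<^sup>2) * indicator {0<..<n} h
        = ennreal ((h - r) / h\<^sup>2) * indicator {r..n} h"
      by eventually_elim (use r in \<open>auto simp: indicator_def ennreal_neg divide_nonpos_nonneg\<close>)
  qed
  also have "\<dots> = ennreal ((ln n + r / n) - (ln r + r / r))"
  proof (rule nn_integral_FTC_Icc)
    fix h assume "h \<in> {r..n}"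
    then have h: "r \<le> h" "h \<le> n" by auto
    then have "h > 0" using r by simp
    then show "((\<lambda>h. ln h + r / h) has_real_derivative (h - r) / h\<^sup>2) (at h)"
      by (auto intro!: derivative_eq_intros simp: power2_eq_square field_simps)
    show "0 \<le> (h - r) / h\<^sup>2" using h by simp
  qed (use r in simp_all)
  also have "(ln n + r / n) - (ln r + r / r) = ln n - ln r - 1 + r / n" using r by simp
  finally show ?thesis unfolding window_kernel_eq r_def .
qed

text \<open>
  Comparison with points at a small distance, using that the overlap decreases with the distance.
\<close>

lemma window_kernel_diag: "window_kernel n s s = \<infinity>" if n: "n > 0"
proof -
  have "ennreal x \<le> window_kernel n s s" for x :: real
  proof -
    define e where "e = min (n / 2) (exp (ln n - 1 - x))"
    have e: "0 < e" "e < n" using n by (auto simp: e_def)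
    have "ln e \<le> ln (exp (ln n - 1 - x))" using e by (subst ln_le_cancel_iff) (auto simp: e_def)
    moreover have "0 \<le> e / n" using e n by simp
    ultimately have "x \<le> ln n - ln e - 1 + e / n" using e n by (simp only: ln_exp)
    then have "ennreal x \<le> window_kernel n (s + e) s"
      using window_kernel_near[of "s + e" s n] e by (simp add: ennreal_leI)
    also have "\<dots> \<le> window_kernel n s s"
      unfolding window_kernel_eq using e
      by (intro nn_integral_mono mult_right_mono ennreal_leI divide_right_mono) auto
    finally show ?thesis .
  qed
  then show ?thesis
    by (metis ennreal_cases ennreal_le_iff2 infinity_ennreal_def less_add_one not_le add_nonneg_pos zero_less_one)
qed

text \<open>
  With the next lemma: after adding the constant \<open>ln n - 1\<close>, the logarithmic kernel differs from the window kernel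
  with the same quadratic terms by at most \<open>|s - t| / n\<close>. The bound \<open>n \<ge> 3\<close> makes that constant nonnegative, so no subtraction is needed.
\<close>

lemma log_kernel_le_window:
  assumes n: "n \<ge> 3"
  shows "log_kernel s t + ennreal (ln n - 1) \<le> window_kernel n s t + ennreal ((s\<^sup>2 + t\<^sup>2) / 2)"
proof -
  have lnn: "ln n - 1 \<ge> 0" using n exp_le by (simp add: ln_ge_iff)
  consider "s = t" | "0 < \<bar>s - t\<bar>" "\<bar>s - t\<bar> < n" | "\<bar>s - t\<bar> \<ge> n" using n by fastforce
  then show ?thesis
  proof cases
    case 1
    then show ?thesis using n by (simp add: window_kernel_diag)
  next
    case 2
    have "ln (\<bar>s - t\<bar> / n) \<le> \<bar>s - t\<bar> / n - 1" using 2 by (intro ln_le_minus_one) simp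
    then have pos: "0 \<le> ln n - ln \<bar>s - t\<bar> - 1 + \<bar>s - t\<bar> / n" using 2 by (simp add: ln_div)
    show ?thesis
      unfolding window_kernel_near[OF 2] using 2 lnn pos log_kernel_nonneg[of s t] n
      by (auto simp: log_kernel_def simp flip: ennreal_plus intro!: ennreal_leI)
  next
    case 3
    then have lnr: "ln n \<le> ln \<bar>s - t\<bar>" using n by (subst ln_le_cancel_iff) auto
    have "log_kernel s t + ennreal (ln n - 1) \<le> ennreal ((s\<^sup>2 + t\<^sup>2) / 2)"
    proof -
      have "- ln \<bar>s - t\<bar> + (s\<^sup>2 + t\<^sup>2) / 2 + (ln n - 1) \<le> (s\<^sup>2 + t\<^sup>2) / 2" using lnr by linarith
      moreover have "s \<noteq> t" using 3 n by auto
      ultimately show ?thesis using lnn log_kernel_nonneg[of s t]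
        by (simp add: log_kernel_def ennreal_leI flip: ennreal_plus)
    qed
    then show ?thesis by (simp add: add_increasing)
  qed
qed

lemma window_le_log_kernel:
  assumes n: "n \<ge> 3"
  shows "window_kernel n s t + ennreal ((s\<^sup>2 + t\<^sup>2) / 2)
    \<le> log_kernel s t + ennreal (ln n - 1) + ennreal (\<bar>s - t\<bar> / n)"
proof -
  have lnn: "ln n - 1 \<ge> 0" using n exp_le by (simp add: ln_ge_iff)
  consider "s = t" | "0 < \<bar>s - t\<bar>" "\<bar>s - t\<bar> < n" | "\<bar>s - t\<bar> \<ge> n" using n by fastforce
  then show ?thesis
  proof cases
    case 1
    then show ?thesis by (simp add: log_kernel_def)
  next
    case 2
    have "ln (\<bar>s - t\<bar> / n) \<le> \<bar>s - t\<bar> / n - 1" using 2 by (intro ln_le_minus_one) simp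
    then have pos: "0 \<le> ln n - ln \<bar>s - t\<bar> - 1 + \<bar>s - t\<bar> / n" using 2 by (simp add: ln_div)
    show ?thesis
      unfolding window_kernel_near[OF 2] using 2 lnn pos log_kernel_nonneg[of s t] n
      by (auto simp: log_kernel_def simp flip: ennreal_plus intro!: ennreal_leI)
  next
    case 3
    have "ennreal ((h - \<bar>s - t\<bar>) / h\<^sup>2) * indicator {0<..<n} h = 0" for h
      using 3 by (auto simp: indicator_def ennreal_neg divide_nonpos_nonneg)
    then have 0: "window_kernel n s t = 0" unfolding window_kernel_eq by (simp only: nn_integral_0_iff_AE) simp
    have ne: "s \<noteq> t" using 3 n by auto
    have "ln (\<bar>s - t\<bar> / n) \<le> \<bar>s - t\<bar> / n - 1" using 3 n by (intro ln_le_minus_one) simp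
    then have "ln \<bar>s - t\<bar> \<le> ln n - 1 + \<bar>s - t\<bar> / n" using ne 3 n by (simp add: ln_div)
    then show ?thesis
      using 3 n lnn log_kernel_nonneg[of s t]
      by (auto simp: 0 log_kernel_def add_divide_distrib simp flip: ennreal_plus intro!: ennreal_leI)
  qed
qed

text \<open>
  This is where positive definiteness comes from: for \<open>\<nu> = \<rho>\<close> the right-hand side is an integral of squares.
\<close>

lemma mixture_energy:
  assumes "sigma_finite_measure L" "sigma_finite_measure \<nu>" "sigma_finite_measure \<rho>"
    and [measurable_cong]: "sets \<nu> = sets N" "sets \<rho> = sets N"
    and [measurable]: "w \<in> borel_measurable L" "case_prod \<phi> \<in> borel_measurable (N \<Otimes>\<^sub>M L)"
  shows "(\<integral>\<^sup>+ s. \<integral>\<^sup>+ t. \<integral>\<^sup>+ p. w p * (\<phi> s p * \<phi> t p) \<partial>L \<partial>\<rho> \<partial>\<nu>)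
    = (\<integral>\<^sup>+ p. w p * ((\<integral>\<^sup>+ s. \<phi> s p \<partial>\<nu>) * (\<integral>\<^sup>+ t. \<phi> t p \<partial>\<rho>)) \<partial>L)"
proof -
  interpret L: sigma_finite_measure L by fact
  interpret \<nu>: sigma_finite_measure \<nu> by fact
  interpret \<rho>: sigma_finite_measure \<rho> by fact
  interpret \<nu>L: pair_sigma_finite \<nu> L ..
  interpret \<rho>L: pair_sigma_finite \<rho> L ..
  have [measurable]: "(\<lambda>p. \<integral>\<^sup>+ t. \<phi> t p \<partial>\<rho>) \<in> borel_measurable L" by measurable
  have "(\<integral>\<^sup>+ s. \<integral>\<^sup>+ t. \<integral>\<^sup>+ p. w p * (\<phi> s p * \<phi> t p) \<partial>L \<partial>\<rho> \<partial>\<nu>)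
      = (\<integral>\<^sup>+ s. \<integral>\<^sup>+ p. w p * (\<phi> s p * (\<integral>\<^sup>+ t. \<phi> t p \<partial>\<rho>)) \<partial>L \<partial>\<nu>)"
  proof (rule nn_integral_cong)
    fix s assume "s \<in> space \<nu>"
    then have s: "s \<in> space N" using sets_eq_imp_space_eq[OF assms(4)] by simp
    have "(\<integral>\<^sup>+ t. \<integral>\<^sup>+ p. w p * (\<phi> s p * \<phi> t p) \<partial>L \<partial>\<rho>)
        = (\<integral>\<^sup>+ p. \<integral>\<^sup>+ t. w p * (\<phi> s p * \<phi> t p) \<partial>\<rho> \<partial>L)"
      using s by (intro \<rho>L.Fubini'[symmetric]) (auto simp: split_beta)
    also have "\<dots> = (\<integral>\<^sup>+ p. w p * (\<phi> s p * (\<integral>\<^sup>+ t. \<phi> t p \<partial>\<rho>)) \<partial>L)"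
      by (intro nn_integral_cong) (simp add: nn_integral_cmult flip: mult.assoc)
    finally show "(\<integral>\<^sup>+ t. \<integral>\<^sup>+ p. w p * (\<phi> s p * \<phi> t p) \<partial>L \<partial>\<rho>)
        = (\<integral>\<^sup>+ p. w p * (\<phi> s p * (\<integral>\<^sup>+ t. \<phi> t p \<partial>\<rho>)) \<partial>L)" .
  qed
  also have "\<dots> = (\<integral>\<^sup>+ p. \<integral>\<^sup>+ s. w p * (\<phi> s p * (\<integral>\<^sup>+ t. \<phi> t p \<partial>\<rho>)) \<partial>\<nu> \<partial>L)"
    by (intro \<nu>L.Fubini'[symmetric]) (auto simp: split_beta)
  also have "\<dots> = (\<integral>\<^sup>+ p. w p * ((\<integral>\<^sup>+ s. \<phi> s p \<partial>\<nu>) * (\<integral>\<^sup>+ t. \<phi> t p \<partial>\<rho>)) \<partial>L)"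
    by (intro nn_integral_cong) (simp add: nn_integral_cmult nn_integral_multc)
  finally show ?thesis .
qed


text \<open>
  Only the windows of length less than \<open>1\<close> are counted, so that the distance does not depend on the cut-off \<open>n\<close>
  of the approximating kernels.
\<close>

definition window_distance :: "real measure \<Rightarrow> real measure \<Rightarrow> ennreal" where
  "window_distance \<nu> \<rho> = (\<integral>\<^sup>+ p. weight 1 (fst p) *
     ennreal ((measure \<nu> {snd p<..snd p + fst p} - measure \<rho> {snd p<..snd p + fst p})\<^sup>2)
     \<partial>(lborel \<Otimes>\<^sub>M lborel))"

lemma window_mass:
  fixes \<nu> :: "real measure"
  assumes \<nu>: "prob_space \<nu>" "sets \<nu> = sets borel"
  shows "(\<integral>\<^sup>+ s. window s p \<partial>\<nu>) = ennreal (measure \<nu> {snd p<..snd p + fst p})"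
proof -
  interpret prob_space \<nu> by (rule \<nu>)
  show ?thesis using \<nu>(2) by (simp add: window_def emeasure_eq_measure)
qed

lemma window_mass_measurable:
  fixes \<nu> :: "real measure"
  assumes \<nu>: "prob_space \<nu>" "sets \<nu> = sets borel"
  shows "(\<lambda>p. measure \<nu> {snd p<..snd p + fst p}) \<in> borel_measurable (lborel \<Otimes>\<^sub>M lborel)"
proof -
  interpret prob_space \<nu> by (rule \<nu>)
  note [measurable_cong] = \<nu>(2)
  have "(\<lambda>p. enn2real (\<integral>\<^sup>+ s. window s p \<partial>\<nu>)) \<in> borel_measurable (lborel \<Otimes>\<^sub>M lborel)"
    unfolding window_def indicator_def greaterThanAtMost_iff by measurable
  then show ?thesis by (simp add: window_mass[OF \<nu>])
qed

lemma window_energy: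
  fixes \<nu> \<rho> :: "real measure"
  assumes "prob_space \<nu>" "prob_space \<rho>" "sets \<nu> = sets borel" "sets \<rho> = sets borel"
  shows "(\<integral>\<^sup>+ s. \<integral>\<^sup>+ t. window_kernel n s t \<partial>\<rho> \<partial>\<nu>)
    = (\<integral>\<^sup>+ p. weight n (fst p) * (ennreal (measure \<nu> {snd p<..snd p + fst p})
        * ennreal (measure \<rho> {snd p<..snd p + fst p})) \<partial>(lborel \<Otimes>\<^sub>M lborel))"
  unfolding window_kernel_def
  using assms window_mass[OF assms(1,3)] window_mass[OF assms(2,4)]
  by (subst mixture_energy[where N = borel])
    (auto intro!: lborel_pair.sigma_finite_measure_axioms prob_space_imp_sigma_finite
      simp: split_beta' split del: if_split)

text \<open>
  \<open>(a - b)\<^sup>2 + 2 a b = a\<^sup>2 + b\<^sup>2\<close> for the masses \<open>a\<close>, \<open>b\<close> of each window, integrated over the windows.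
\<close>

lemma window_energy_inequality:
  fixes \<nu> \<rho> :: "real measure"
  assumes p: "prob_space \<nu>" "prob_space \<rho>" "sets \<nu> = sets borel" "sets \<rho> = sets borel"
    and n: "n \<ge> 1"
  shows "window_distance \<nu> \<rho> + 2 * (\<integral>\<^sup>+ s. \<integral>\<^sup>+ t. window_kernel n s t \<partial>\<rho> \<partial>\<nu>)
    \<le> (\<integral>\<^sup>+ s. \<integral>\<^sup>+ t. window_kernel n s t \<partial>\<nu> \<partial>\<nu>) + (\<integral>\<^sup>+ s. \<integral>\<^sup>+ t. window_kernel n s t \<partial>\<rho> \<partial>\<rho>)"
proof -
  define a where "a = (\<lambda>p. measure \<nu> {snd p<..snd p + fst p :: real})"
  define b where "b = (\<lambda>p. measure \<rho> {snd p<..snd p + fst p :: real})"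
  have [measurable]: "a \<in> borel_measurable (lborel \<Otimes>\<^sub>M lborel)" "b \<in> borel_measurable (lborel \<Otimes>\<^sub>M lborel)"
    unfolding a_def b_def by (rule window_mass_measurable[OF p(1,3)], rule window_mass_measurable[OF p(2,4)])
  have pointwise: "weight 1 h * ennreal ((x - y)\<^sup>2) + 2 * (weight n h * (ennreal x * ennreal y))
      \<le> weight n h * (ennreal x * ennreal x) + weight n h * (ennreal y * ennreal y)"
    if "x \<ge> 0" "y \<ge> 0" for x y h
  proof -
    have "weight 1 h * ennreal ((x - y)\<^sup>2) + 2 * (weight n h * (ennreal x * ennreal y))
        \<le> weight n h * ennreal ((x - y)\<^sup>2) + 2 * (weight n h * (ennreal x * ennreal y))"
      using n by (intro add_right_mono mult_right_mono) (auto simp: weight_def indicator_def)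
    also have "\<dots> = weight n h * (ennreal ((x - y)\<^sup>2) + ennreal (2 * (x * y)))"
      using that by (simp add: distrib_left ennreal_mult' mult.left_commute)
    also have "ennreal ((x - y)\<^sup>2) + ennreal (2 * (x * y)) = ennreal (x * x) + ennreal (y * y)"
    proof -
      have "ennreal ((x - y)\<^sup>2) + ennreal (2 * (x * y)) = ennreal ((x - y)\<^sup>2 + 2 * (x * y))"
        using that by (intro ennreal_plus[symmetric]) auto
      also have "(x - y)\<^sup>2 + 2 * (x * y) = x * x + y * y"
        by (simp add: power2_eq_square algebra_simps)
      finally show ?thesis using that by simp
    qed
    also have "weight n h * (ennreal (x * x) + ennreal (y * y))
        = weight n h * (ennreal x * ennreal x) + weight n h * (ennreal y * ennreal y)"
      using that by (simp add: distrib_left ennreal_mult')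
    finally show ?thesis .
  qed
  have "window_distance \<nu> \<rho> + 2 * (\<integral>\<^sup>+ s. \<integral>\<^sup>+ t. window_kernel n s t \<partial>\<rho> \<partial>\<nu>)
    = (\<integral>\<^sup>+ p. weight 1 (fst p) * ennreal ((a p - b p)\<^sup>2)
        + 2 * (weight n (fst p) * (ennreal (a p) * ennreal (b p))) \<partial>(lborel \<Otimes>\<^sub>M lborel))"
    unfolding window_distance_def window_energy[OF p] a_def[symmetric] b_def[symmetric]
    by (simp add: nn_integral_add nn_integral_cmult a_def[symmetric, THEN fun_cong] b_def[symmetric, THEN fun_cong])
  also have "\<dots> \<le> (\<integral>\<^sup>+ p. weight n (fst p) * (ennreal (a p) * ennreal (a p))
        + weight n (fst p) * (ennreal (b p) * ennreal (b p)) \<partial>(lborel \<Otimes>\<^sub>M lborel))"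
    by (intro nn_integral_mono pointwise) (auto simp: a_def b_def)
  also have "\<dots> = (\<integral>\<^sup>+ s. \<integral>\<^sup>+ t. window_kernel n s t \<partial>\<nu> \<partial>\<nu>) + (\<integral>\<^sup>+ s. \<integral>\<^sup>+ t. window_kernel n s t \<partial>\<rho> \<partial>\<rho>)"
    unfolding window_energy[OF p(1,1,3,3)] window_energy[OF p(2,2,4,4)]
    by (simp add: nn_integral_add a_def[symmetric, THEN fun_cong] b_def[symmetric, THEN fun_cong])
  finally show ?thesis .
qed

lemma window_kernel_measurable [measurable (raw)]:
  assumes "f \<in> borel_measurable M" "g \<in> borel_measurable M"
  shows "(\<lambda>x. window_kernel n (f x) (g x)) \<in> borel_measurable M"
proof -
  have "(\<lambda>z. window_kernel n (fst z) (snd z)) \<in> borel_measurable (borel \<Otimes>\<^sub>M borel)"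
    unfolding window_kernel_eq by measurable
  from measurable_compose[OF measurable_Pair[OF assms] this] show ?thesis by simp
qed

text \<open>
  The inequality for window kernels carries over as \<open>n\<close> tends to infinity. The constants \<open>ln n - 1\<close> and the second moments
  occur with the same total on both sides, and only the error \<open>|s - t| / n\<close> is left.
\<close>

lemma log_energy_inequality:
  fixes \<nu> \<rho> :: "real measure"
  assumes p: "prob_space \<nu>" "prob_space \<rho>" "sets \<nu> = sets borel" "sets \<rho> = sets borel"
  shows "window_distance \<nu> \<rho> + 2 * log_energy \<nu> \<rho> \<le> log_energy \<nu> \<nu> + log_energy \<rho> \<rho>"
proof (rule ennreal_le_epsilon)
  interpret \<nu>: prob_space \<nu> by (rule p)
  interpret \<rho>: prob_space \<rho> by (rule p)
  note [measurable_cong] = p(3,4)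
  \<comment> \<open>The energy of the window kernel, half of the second moment, and the mean distance.\<close>
  define N where "N n \<mu> \<mu>' = (\<integral>\<^sup>+ s. \<integral>\<^sup>+ t. window_kernel n s t \<partial>\<mu>' \<partial>\<mu>)" for n and \<mu> \<mu>' :: "real measure"
  define M where "M \<mu> = (\<integral>\<^sup>+ s. ennreal (s\<^sup>2 / 2) \<partial>\<mu>)" for \<mu> :: "real measure"
  define A where "A \<mu> = (\<integral>\<^sup>+ s. \<integral>\<^sup>+ t. ennreal \<bar>s - t\<bar> \<partial>\<mu> \<partial>\<mu>)" for \<mu> :: "real measure"
  have quad: "(\<integral>\<^sup>+ s. \<integral>\<^sup>+ t. ennreal ((s\<^sup>2 + t\<^sup>2) / 2) \<partial>\<mu>' \<partial>\<mu>) = M \<mu> + M \<mu>'"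
    if "prob_space \<mu>" "prob_space \<mu>'" and [measurable_cong]: "sets \<mu> = sets borel" "sets \<mu>' = sets borel"
    for \<mu> \<mu>' :: "real measure"
  proof -
    interpret \<mu>: prob_space \<mu> by fact
    interpret \<mu>': prob_space \<mu>' by fact
    have "(\<integral>\<^sup>+ s. \<integral>\<^sup>+ t. ennreal ((s\<^sup>2 + t\<^sup>2) / 2) \<partial>\<mu>' \<partial>\<mu>)
      = (\<integral>\<^sup>+ s. \<integral>\<^sup>+ t. ennreal (s\<^sup>2 / 2) + ennreal (t\<^sup>2 / 2) \<partial>\<mu>' \<partial>\<mu>)"
      by (simp add: add_divide_distrib)
    also have "\<dots> = (\<integral>\<^sup>+ s. ennreal (s\<^sup>2 / 2) + M \<mu>' \<partial>\<mu>)"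
      by (subst nn_integral_add) (simp_all add: M_def \<mu>'.emeasure_space_1)
    also have "\<dots> = M \<mu> + M \<mu>'"
      by (subst nn_integral_add) (simp_all add: M_def \<mu>.emeasure_space_1)
    finally show ?thesis .
  qed
  have upper: "log_energy \<mu> \<mu>' + ennreal (ln n - 1) \<le> N n \<mu> \<mu>' + (M \<mu> + M \<mu>')"
    if n: "n \<ge> 3" and pr: "prob_space \<mu>" "prob_space \<mu>'"
      and [measurable_cong]: "sets \<mu> = sets borel" "sets \<mu>' = sets borel"
    for \<mu> \<mu>' :: "real measure" and n
  proof -
    interpret \<mu>: prob_space \<mu> by fact
    interpret \<mu>': prob_space \<mu>' by fact
    have "log_energy \<mu> \<mu>' + ennreal (ln n - 1)
        = (\<integral>\<^sup>+ s. \<integral>\<^sup>+ t. log_kernel s t + ennreal (ln n - 1) \<partial>\<mu>' \<partial>\<mu>)"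
      by (simp add: log_energy_def nn_integral_add \<mu>.emeasure_space_1 \<mu>'.emeasure_space_1)
    also have "\<dots> \<le> (\<integral>\<^sup>+ s. \<integral>\<^sup>+ t. window_kernel n s t + ennreal ((s\<^sup>2 + t\<^sup>2) / 2) \<partial>\<mu>' \<partial>\<mu>)"
      by (intro nn_integral_mono log_kernel_le_window n)
    also have "\<dots> = N n \<mu> \<mu>' + (M \<mu> + M \<mu>')"
      using quad[OF pr that(4,5)] by (simp add: nn_integral_add N_def)
    finally show ?thesis .
  qed
  have lower: "N n \<mu> \<mu> + (M \<mu> + M \<mu>) \<le> log_energy \<mu> \<mu> + ennreal (ln n - 1) + A \<mu> * ennreal (1 / n)"
    if n: "n \<ge> 3" and pr: "prob_space \<mu>" and [measurable_cong]: "sets \<mu> = sets borel"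
    for \<mu> :: "real measure" and n
  proof -
    interpret \<mu>: prob_space \<mu> by fact
    have *: "ennreal (\<bar>s - t\<bar> / n) = ennreal \<bar>s - t\<bar> * ennreal (1 / n)" for s t :: real
      by (simp flip: ennreal_mult')
    have "N n \<mu> \<mu> + (M \<mu> + M \<mu>) = (\<integral>\<^sup>+ s. \<integral>\<^sup>+ t. window_kernel n s t + ennreal ((s\<^sup>2 + t\<^sup>2) / 2) \<partial>\<mu> \<partial>\<mu>)"
      using quad[OF pr pr that(3,3)] by (simp add: nn_integral_add N_def)
    also have "\<dots> \<le> (\<integral>\<^sup>+ s. \<integral>\<^sup>+ t. log_kernel s t + ennreal (ln n - 1) + ennreal (\<bar>s - t\<bar> / n) \<partial>\<mu> \<partial>\<mu>)"
      by (intro nn_integral_mono window_le_log_kernel n)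
    also have "\<dots> = log_energy \<mu> \<mu> + ennreal (ln n - 1) + A \<mu> * ennreal (1 / n)"
      unfolding * by (simp add: log_energy_def A_def nn_integral_add nn_integral_multc \<mu>.emeasure_space_1)
    finally show ?thesis .
  qed
  have A: "A \<mu> \<le> log_energy \<mu> \<mu> + 3"
    if pr: "prob_space \<mu>" and [measurable_cong]: "sets \<mu> = sets borel" for \<mu> :: "real measure"
  proof -
    interpret \<mu>: prob_space \<mu> by fact
    have "ennreal \<bar>s - t\<bar> \<le> log_kernel s t + ennreal 3" for s t
    proof (cases "s = t")
      case False
      then have "ennreal \<bar>s - t\<bar> \<le> ennreal (- ln \<bar>s - t\<bar> + (s\<^sup>2 + t\<^sup>2) / 2 + 3)"
        by (intro ennreal_leI log_kernel_bound)
      also have "\<dots> = log_kernel s t + ennreal 3"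
        using False log_kernel_nonneg[OF False] by (subst ennreal_plus) (auto simp: log_kernel_def)
      finally show ?thesis .
    qed (simp add: log_kernel_def)
    then have "A \<mu> \<le> (\<integral>\<^sup>+ s. \<integral>\<^sup>+ t. log_kernel s t + ennreal 3 \<partial>\<mu> \<partial>\<mu>)"
      unfolding A_def by (intro nn_integral_mono)
    also have "\<dots> = log_energy \<mu> \<mu> + 3"
      by (simp add: nn_integral_add log_energy_def \<mu>.emeasure_space_1)
    finally show ?thesis .
  qed
  fix e :: real assume e: "e > 0"
  assume fin: "log_energy \<nu> \<nu> + log_energy \<rho> \<rho> < top"
  \<comment> \<open>The error term is bounded by \<open>(A \<nu> + A \<rho>) / n\<close>; the choice of \<open>n\<close> makes it at most \<open>e\<close>.\<close>
  have "A \<nu> + A \<rho> < \<infinity>"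
    using A[OF p(1,3)] A[OF p(2,4)] fin by (auto simp: less_top[symmetric] top_unique)
  then obtain a where a: "A \<nu> + A \<rho> = ennreal a" "a \<ge> 0"
    by (cases "A \<nu> + A \<rho>") auto
  define n where "n = max 3 (a / e)"
  have n: "n \<ge> 3" by (simp add: n_def)
  have "a / e \<le> n" by (simp add: n_def)
  then have an: "a / n \<le> e" using e n by (simp add: field_simps)
  define C where "C = ennreal (ln n - 1)"
  have "window_distance \<nu> \<rho> + 2 * log_energy \<nu> \<rho> + 2 * C
      = window_distance \<nu> \<rho> + 2 * (log_energy \<nu> \<rho> + C)"
    by (simp add: distrib_left add.assoc)
  also have "\<dots> \<le> window_distance \<nu> \<rho> + 2 * (N n \<nu> \<rho> + (M \<nu> + M \<rho>))"
    unfolding C_def by (intro add_left_mono mult_left_mono upper n p) auto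
  also have "\<dots> = (window_distance \<nu> \<rho> + 2 * N n \<nu> \<rho>) + 2 * (M \<nu> + M \<rho>)"
    by (simp add: distrib_left add.assoc)
  also have "\<dots> \<le> (N n \<nu> \<nu> + N n \<rho> \<rho>) + 2 * (M \<nu> + M \<rho>)"
    using window_energy_inequality[OF p, of n] n by (intro add_right_mono) (simp add: N_def)
  also have "\<dots> = (N n \<nu> \<nu> + (M \<nu> + M \<nu>)) + (N n \<rho> \<rho> + (M \<rho> + M \<rho>))"
    by (simp only: mult_2 ac_simps)
  also have "\<dots> \<le> (log_energy \<nu> \<nu> + C + A \<nu> * ennreal (1 / n)) + (log_energy \<rho> \<rho> + C + A \<rho> * ennreal (1 / n))"
    unfolding C_def by (intro add_mono lower n p)
  also have "\<dots> = (log_energy \<nu> \<nu> + log_energy \<rho> \<rho> + (A \<nu> + A \<rho>) * ennreal (1 / n)) + 2 * C"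
    by (simp only: mult_2 distrib_right add_ac)
  finally have "window_distance \<nu> \<rho> + 2 * log_energy \<nu> \<rho>
      \<le> log_energy \<nu> \<nu> + log_energy \<rho> \<rho> + (A \<nu> + A \<rho>) * ennreal (1 / n)"
    \<comment> \<open>Cancelling \<open>2 * C\<close> is legitimate because it is finite.\<close>
    by (subst (asm) (1 2) add.commute[of _ "2 * C"], subst (asm) ennreal_add_left_cancel_le)
      (auto simp: C_def ennreal_mult_eq_top_iff)
  also have "(A \<nu> + A \<rho>) * ennreal (1 / n) = ennreal (a / n)"
    unfolding a(1) using a n by (simp flip: ennreal_mult')
  also have "log_energy \<nu> \<nu> + log_energy \<rho> \<rho> + ennreal (a / n) \<le> log_energy \<nu> \<nu> + log_energy \<rho> \<rho> + ennreal e"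
    by (intro add_left_mono ennreal_leI an)
  finally show "window_distance \<nu> \<rho> + 2 * log_energy \<nu> \<rho> \<le> log_energy \<nu> \<nu> + log_energy \<rho> \<rho> + ennreal e" .
qed

lemma AE_lborel_interval:
  assumes AE: "AE x in lborel. P x" and ab: "a < (b :: real)"
  shows "\<exists>x. a < x \<and> x < b \<and> P x"
proof (rule ccontr)
  assume no: "\<nexists>x. a < x \<and> x < b \<and> P x"
  have "AE x in lborel. x \<notin> {a<..<b}"
    using AE by eventually_elim (use no in auto)
  then have "{a<..<b} \<in> null_sets lborel"
    by (subst (asm) AE_iff_null_sets[symmetric]) auto
  then show False using ab by (auto simp: null_sets_def)
qed

lemma right_continuous_AE_zero:
  fixes D :: "real \<Rightarrow> real"
  assumes cont: "continuous (at_right u) D" and AE: "AE v in lborel. D v = 0"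
  shows "D u = 0"
proof (rule ccontr)
  assume "D u \<noteq> 0"
  with cont have "eventually (\<lambda>v. D v \<noteq> 0) (at_right u)"
    by (intro tendsto_imp_eventually_ne) (auto simp: continuous_within)
  then obtain b where b: "b > u" "\<And>v. u < v \<Longrightarrow> v < b \<Longrightarrow> D v \<noteq> 0"
    by (auto simp: eventually_at_right_field)
  with AE_lborel_interval[OF AE b(1)] show False by auto
qed

text \<open>
  Equal masses for almost all windows give one length \<open>h\<close> with equal masses for almost all, hence by right
  continuity for all, windows of length \<open>h\<close>. Then the difference of the distribution functions has
  period \<open>h\<close>, and it tends to \<open>0\<close> at \<open>-\<infinity>\<close>.
\<close>

lemma window_distance_zero_imp_eq:
  fixes \<nu> \<rho> :: "real measure"
  assumes p: "prob_space \<nu>" "prob_space \<rho>" "sets \<nu> = sets borel" "sets \<rho> = sets borel"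
    and zero: "window_distance \<nu> \<rho> = 0"
  shows "\<nu> = \<rho>"
proof -
  interpret \<nu>: real_distribution \<nu> using p by (simp add: real_distribution_def real_distribution_axioms_def)
  interpret \<rho>: real_distribution \<rho> using p by (simp add: real_distribution_def real_distribution_axioms_def)
  define d where "d = (\<lambda>p. measure \<nu> {snd p<..snd p + fst p} - measure \<rho> {snd p<..snd p + fst p :: real})"
  have [measurable]: "d \<in> borel_measurable (lborel \<Otimes>\<^sub>M lborel)"
    unfolding d_def by (intro borel_measurable_diff window_mass_measurable[OF p(1,3)] window_mass_measurable[OF p(2,4)])
  have [measurable]: "(\<lambda>u. d (h, u)) \<in> borel_measurable lborel" for h by measurable
  have "(\<integral>\<^sup>+ h. \<integral>\<^sup>+ u. weight 1 h * ennreal ((d (h, u))\<^sup>2) \<partial>lborel \<partial>lborel) = window_distance \<nu> \<rho>"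
    unfolding window_distance_def d_def[symmetric, THEN fun_cong]
    by (subst lborel.nn_integral_fst[symmetric]) (auto simp: d_def[symmetric, THEN fun_cong])
  then have "(\<integral>\<^sup>+ h. \<integral>\<^sup>+ u. weight 1 h * ennreal ((d (h, u))\<^sup>2) \<partial>lborel \<partial>lborel) = 0"
    using zero by simp
  then have "AE h in lborel. (\<integral>\<^sup>+ u. weight 1 h * ennreal ((d (h, u))\<^sup>2) \<partial>lborel) = 0"
    by (subst (asm) nn_integral_0_iff_AE) auto
  from AE_lborel_interval[OF this, of 0 1] obtain h where h: "0 < h" "h < 1"
    and "(\<integral>\<^sup>+ u. weight 1 h * ennreal ((d (h, u))\<^sup>2) \<partial>lborel) = 0"
    by auto
  then have "AE u in lborel. weight 1 h * ennreal ((d (h, u))\<^sup>2) = 0"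
    by (subst (asm) nn_integral_0_iff_AE) auto
  then have "AE u in lborel. d (h, u) = 0"
    by eventually_elim (use h in \<open>auto simp: weight_def\<close>)
  moreover define G where "G = (\<lambda>u. cdf \<nu> u - cdf \<rho> u)"
  have d: "d (h, u) = G (u + h) - G u" for u
    using \<nu>.cdf_diff_eq[of u "u + h"] \<rho>.cdf_diff_eq[of u "u + h"] h by (simp add: d_def G_def)
  ultimately have AE: "AE u in lborel. G (u + h) - G u = 0" by simp
  have "continuous (at_right u) (\<lambda>u. G (u + h) - G u)" for u
  proof -
    have G: "continuous (at_right v) G" for v
      unfolding G_def by (intro continuous_diff \<nu>.cdf_is_right_cont \<rho>.cdf_is_right_cont)
    have "((\<lambda>u. G (u + h)) \<longlongrightarrow> G (u + h)) (at_right u)"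
      using G[of "u + h"] unfolding continuous_within
      by (subst filterlim_at_right_to_0, subst (asm) filterlim_at_right_to_0) (simp add: add.assoc)
    then show ?thesis using G[of u] unfolding continuous_within by (intro tendsto_intros)
  qed
  from right_continuous_AE_zero[OF this AE] have step: "G (u + h) = G u" for u by simp
  have "G u = 0" for u
  proof -
    have "G (u - real k * h) = G u" for k
    proof (induction k)
      case (Suc k)
      then show ?case using step[of "u - real (Suc k) * h"] by (simp add: algebra_simps)
    qed simp
    moreover have "(\<lambda>k. G (u - real k * h)) \<longlonglongrightarrow> 0 - 0"
      unfolding G_def
    proof (intro tendsto_diff)
      have lim: "filterlim (\<lambda>k. u - real k * h) at_bot sequentially" using h by real_asymp
      show "(\<lambda>k. cdf \<nu> (u - real k * h)) \<longlonglongrightarrow> 0"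
        by (rule filterlim_compose[OF \<nu>.cdf_lim_at_bot lim])
      show "(\<lambda>k. cdf \<rho> (u - real k * h)) \<longlonglongrightarrow> 0"
        by (rule filterlim_compose[OF \<rho>.cdf_lim_at_bot lim])
    qed
    ultimately show ?thesis by (simp add: LIMSEQ_const_iff)
  qed
  then have "cdf \<nu> = cdf \<rho>" by (auto simp: G_def)
  then show ?thesis by (rule cdf_unique[OF \<nu>.real_distribution_axioms \<rho>.real_distribution_axioms])
qed

section \<open>The planar energy as a mean of logarithmic energies\<close>

definition angle_measure :: "real measure" where
  "angle_measure =
    density lborel (\<lambda>\<theta>. ennreal (2 / pi * (sin \<theta>)\<^sup>2) * indicator {0<..<pi} \<theta>)"

lemma sets_angle [simp, measurable_cong]: "sets angle_measure = sets borel"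
  by (simp add: angle_measure_def)

lemma AE_angle: "(AE \<theta> in angle_measure. P \<theta>) \<longleftrightarrow> (AE \<theta> in lborel. \<theta> \<in> {0<..<pi} \<longrightarrow> P \<theta>)"
proof -
  have "0 < ennreal (2 / pi * (sin \<theta>)\<^sup>2) * indicator {0<..<pi} \<theta> \<longleftrightarrow> \<theta> \<in> {0<..<pi}" for \<theta>
    using sin_gt_zero[of \<theta>] by (auto simp: indicator_def ennreal_zero_less_mult_iff zero_less_mult_iff)
  then show ?thesis
    unfolding angle_measure_def by (subst AE_density) auto
qed

text \<open>
  A gauge integral with explicit value gives the integral of a nonnegative function directly. When \<open>g\<close> is a logarithmic
  kernel, the exceptional set \<open>Z\<close> contains the angles at which it takes the value \<open>\<infinity>\<close>.
\<close>

lemma nn_integral_angle: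
  assumes [measurable]: "g \<in> borel_measurable borel" and Z: "finite Z"
    and g: "\<And>\<theta>. \<lbrakk>0 < \<theta>; \<theta> < pi; \<theta> \<notin> Z\<rbrakk> \<Longrightarrow> 0 \<le> f \<theta> \<and> g \<theta> = ennreal (f \<theta>)"
    and I: "((\<lambda>\<theta>. 2 / pi * (sin \<theta>)\<^sup>2 * f \<theta>) has_integral I) {0..pi}"
  shows "(\<integral>\<^sup>+ \<theta>. g \<theta> \<partial>angle_measure) = ennreal I"
proof -
  define f' where "f' \<theta> = (if \<theta> \<in> insert 0 (insert pi Z) then 0 else 2 / pi * (sin \<theta>)\<^sup>2 * f \<theta>)" for \<theta>
  have "(f' has_integral I) {0..pi}"
    by (rule has_integral_spike_finite[OF _ _ I, of "insert 0 (insert pi Z)"]) (use Z in \<open>auto simp: f'_def\<close>)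
  moreover have "0 \<le> f' \<theta>" if "\<theta> \<in> {0..pi}" for \<theta>
    using that g[of \<theta>] by (auto simp: f'_def)
  ultimately have "(\<integral>\<^sup>+ \<theta>. ennreal (f' \<theta>) * indicator {0..pi} \<theta> \<partial>lborel) = ennreal I"
    by (intro nn_integral_has_integral_lebesgue')
  moreover have "(\<integral>\<^sup>+ \<theta>. g \<theta> \<partial>angle_measure) = (\<integral>\<^sup>+ \<theta>. ennreal (f' \<theta>) * indicator {0..pi} \<theta> \<partial>lborel)"
  proof -
    have "(\<integral>\<^sup>+ \<theta>. g \<theta> \<partial>angle_measure) =
        (\<integral>\<^sup>+ \<theta>. ennreal (2 / pi * (sin \<theta>)\<^sup>2) * indicator {0<..<pi} \<theta> * g \<theta> \<partial>lborel)"
      unfolding angle_measure_def by (rule nn_integral_density) auto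
    also have "\<dots> = (\<integral>\<^sup>+ \<theta>. ennreal (f' \<theta>) * indicator {0..pi} \<theta> \<partial>lborel)"
    proof (rule nn_integral_cong_AE)
      have "insert 0 (insert pi Z) \<in> null_sets lborel"
        using Z by (intro finite_imp_null_set_lborel) auto
      then have "AE \<theta> in lborel. \<theta> \<notin> insert 0 (insert pi Z)" by (rule AE_not_in)
      then show "AE \<theta> in lborel. ennreal (2 / pi * (sin \<theta>)\<^sup>2) * indicator {0<..<pi} \<theta> * g \<theta>
          = ennreal (f' \<theta>) * indicator {0..pi} \<theta>"
      proof eventually_elim
        case (elim \<theta>)
        show ?case
        proof (cases "\<theta> \<in> {0<..<pi}")
          case True
          then have "0 \<le> f \<theta>" "g \<theta> = ennreal (f \<theta>)" using elim g[of \<theta>] by auto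
          then show ?thesis using True elim by (simp add: f'_def flip: ennreal_mult'')
        next
          case False
          then show ?thesis using elim by (auto simp: indicator_def)
        qed
      qed
    qed
    finally show ?thesis .
  qed
  ultimately show ?thesis by simp
qed

lemma sin_square_has_integral: "((\<lambda>\<theta>. 2 / pi * (sin \<theta>)\<^sup>2) has_integral 1) {0..pi}"
proof -
  have "((\<lambda>\<theta>. 2 * (sin \<theta>)\<^sup>2) has_integral
      ((pi - sin pi * cos pi) - (0 - sin 0 * cos 0))) {0..pi}"
    by (rule fundamental_theorem_of_calculus)
      (auto intro!: derivative_eq_intros simp: sin_squared_eq power2_eq_square algebra_simps
        simp flip: has_real_derivative_iff_has_vector_derivative)
  from has_integral_mult_right[OF this, of "1 / pi"] show ?thesis by simp
qed

lemma nn_integral_angle_const: "(\<integral>\<^sup>+ \<theta>. c \<partial>angle_measure) = c"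
proof -
  have "(\<integral>\<^sup>+ \<theta>. 1 \<partial>angle_measure) = ennreal 1"
    by (rule nn_integral_angle[where Z = "{}" and f = "\<lambda>_. 1"]) (use sin_square_has_integral in auto)
  then show ?thesis by simp
qed

lemma prob_space_angle: "prob_space angle_measure"
  by (rule prob_spaceI) (use nn_integral_angle_const[of 1] in simp)

text \<open>
  Since \<open>2 sin\<^sup>2 \<theta> = 1 - cos 2\<theta>\<close>, only the mean value and the second harmonics of \<^const>\<open>logsin\<close> enter,
  and of these only the coefficient of \<open>cos 2u\<close> is not zero.
\<close>

lemma sin_square_logsin_shift:
  "((\<lambda>\<theta>. 2 / pi * (sin \<theta>)\<^sup>2 * logsin (\<theta> + \<alpha>)) has_integral cos (2 * \<alpha>) / 2) {0..pi}"
proof -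
  let ?h = "\<lambda>u. 1 / pi * (logsin u - cos (2 * \<alpha>) * (cos (2 * u) * logsin u)
      - sin (2 * \<alpha>) * (sin (2 * u) * logsin u))"
  have "(?h has_integral 1 / pi * (0 - cos (2 * \<alpha>) * (- pi / 2) - sin (2 * \<alpha>) * 0)) {\<alpha>..\<alpha> + pi}"
    by (intro has_integral_mult_right has_integral_diff logsin_period logsin_cos2_period logsin_sin2_period)
  then have "(?h has_integral cos (2 * \<alpha>) / 2) {0 + \<alpha>..pi + \<alpha>}"
    by (simp add: add.commute)
  then have "((?h \<circ> (+) \<alpha>) has_integral cos (2 * \<alpha>) / 2) {0..pi}"
    by (subst has_integral_shift_Icc_real)
  moreover have "(?h \<circ> (+) \<alpha>) \<theta> = 2 / pi * (sin \<theta>)\<^sup>2 * logsin (\<theta> + \<alpha>)" for \<theta>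
  proof -
    have "cos (2 * \<theta>) = cos (2 * (\<alpha> + \<theta>) - 2 * \<alpha>)" by (simp add: algebra_simps)
    also have "\<dots> = cos (2 * \<alpha>) * cos (2 * (\<alpha> + \<theta>)) + sin (2 * \<alpha>) * sin (2 * (\<alpha> + \<theta>))"
      by (simp only: cos_diff mult.commute)
    finally have "2 * (sin \<theta>)\<^sup>2 = 1 - (cos (2 * \<alpha>) * cos (2 * (\<alpha> + \<theta>)) + sin (2 * \<alpha>) * sin (2 * (\<alpha> + \<theta>)))"
      using cos_double_sin[of \<theta>] by linarith
    then have "2 / pi * (sin \<theta>)\<^sup>2 * logsin (\<theta> + \<alpha>) = 1 / pi *
       ((1 - (cos (2 * \<alpha>) * cos (2 * (\<alpha> + \<theta>)) + sin (2 * \<alpha>) * sin (2 * (\<alpha> + \<theta>)))) * logsin (\<alpha> + \<theta>))"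
      by (simp add: add.commute)
    then show ?thesis by (simp add: algebra_simps diff_divide_distrib add_divide_distrib)
  qed
  ultimately show ?thesis by (simp only: fun_eq_iff cong: has_integral_cong)
qed

text \<open>
  Multiplied by \<open>sin \<theta>\<close>, this is the coordinate of \<open>x\<close> in the direction \<open>(cos \<theta>, sin \<theta>)\<close>. The normalisation
  makes it the identity on the vertical axis, for all \<open>\<theta>\<close>.
\<close>

definition shear :: "real \<Rightarrow> plane \<Rightarrow> real" where
  "shear \<theta> x = snd x + fst x * (cos \<theta> / sin \<theta>)"

lemma sin_shear:
  assumes "sin \<theta> \<noteq> 0"
  shows "sin \<theta> * shear \<theta> x = snd x * sin \<theta> + fst x * cos \<theta>"
  using assms by (simp add: shear_def field_simps)

lemma shear_square_has_integral:
  "((\<lambda>\<theta>. (snd x * sin \<theta> + fst x * cos \<theta>)\<^sup>2 / pi) has_integral (norm x)\<^sup>2 / 2) {0..pi}"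
proof -
  let ?F = "\<lambda>\<theta>. ((snd x)\<^sup>2 * (\<theta> - sin \<theta> * cos \<theta>) / 2 + (fst x)\<^sup>2 * (\<theta> + sin \<theta> * cos \<theta>) / 2
      + fst x * snd x * (sin \<theta>)\<^sup>2)"
  have "((\<lambda>\<theta>. (snd x * sin \<theta> + fst x * cos \<theta>)\<^sup>2) has_integral (?F pi - ?F 0)) {0..pi}"
  proof (rule fundamental_theorem_of_calculus)
    fix \<theta> :: real
    have "(?F has_real_derivative ((snd x)\<^sup>2 * (1 - (cos \<theta> * cos \<theta> - sin \<theta> * sin \<theta>)) / 2
        + (fst x)\<^sup>2 * (1 + (cos \<theta> * cos \<theta> - sin \<theta> * sin \<theta>)) / 2
        + fst x * snd x * (2 * (sin \<theta> * cos \<theta>)))) (at \<theta> within {0..pi})"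
      by (auto intro!: derivative_eq_intros simp: field_simps)
    also have "1 - (cos \<theta> * cos \<theta> - sin \<theta> * sin \<theta>) = 2 * (sin \<theta>)\<^sup>2"
      using sin_squared_eq[of \<theta>] by (simp add: power2_eq_square)
    also have "1 + (cos \<theta> * cos \<theta> - sin \<theta> * sin \<theta>) = 2 * (cos \<theta>)\<^sup>2"
      using sin_squared_eq[of \<theta>] by (simp add: power2_eq_square)
    also have "((snd x)\<^sup>2 * (2 * (sin \<theta>)\<^sup>2) / 2 + (fst x)\<^sup>2 * (2 * (cos \<theta>)\<^sup>2) / 2
        + fst x * snd x * (2 * (sin \<theta> * cos \<theta>))) = (snd x * sin \<theta> + fst x * cos \<theta>)\<^sup>2"
      by (simp add: power2_eq_square algebra_simps)
    finally show "(?F has_vector_derivative (snd x * sin \<theta> + fst x * cos \<theta>)\<^sup>2) (at \<theta> within {0..pi})"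
      by (simp add: has_real_derivative_iff_has_vector_derivative)
  qed simp
  moreover have "?F pi - ?F 0 = pi * ((norm x)\<^sup>2 / 2)"
    by (cases x) (simp add: norm_Pair field_simps)
  ultimately have "((\<lambda>\<theta>. (snd x * sin \<theta> + fst x * cos \<theta>)\<^sup>2) has_integral pi * ((norm x)\<^sup>2 / 2)) {0..pi}"
    by (simp only:)
  from has_integral_mult_right[OF this, of "1 / pi"] show ?thesis by simp
qed

lemma shear_measurable [measurable (raw)]:
  assumes [measurable]: "f \<in> borel_measurable M" "g \<in> M \<rightarrow>\<^sub>M borel"
  shows "(\<lambda>x. shear (f x) (g x)) \<in> borel_measurable M"
proof -
  have [measurable]: "(fst :: plane \<Rightarrow> real) \<in> borel_measurable borel" "(snd :: plane \<Rightarrow> real) \<in> borel_measurable borel"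
    by (auto intro!: borel_measurable_continuous_onI continuous_intros)
  show ?thesis unfolding shear_def by measurable
qed

text \<open>
  In polar coordinates \<open>x - y = r (sin \<alpha>, cos \<alpha>)\<close> the difference of the projections is
  \<open>r sin (\<theta> + \<alpha>) / sin \<theta>\<close>. The mean of its logarithm is \<open>ln r + (cos 2\<alpha> - 1) / 2 = ln r - sin\<^sup>2 \<alpha>\<close>, and
  \<open>sin\<^sup>2 \<alpha>\<close> is the anisotropic term of \<^const>\<open>V\<close>.
\<close>

lemma energy_density_mixture:
  "e2ennreal (energy_density x y) = (\<integral>\<^sup>+ \<theta>. log_kernel (shear \<theta> x) (shear \<theta> y) \<partial>angle_measure)"
proof (cases "x = y")
  case True
  then show ?thesis
    by (simp add: energy_density_def V_def log_kernel_def
        prob_space.emeasure_space_1[OF prob_space_angle])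
next
  case False
  define z where "z = x - y"
  define r where "r = norm z"
  have r: "r > 0" using False by (simp add: r_def z_def)
  have r2: "r\<^sup>2 = (fst z)\<^sup>2 + (snd z)\<^sup>2" by (cases z) (simp add: r_def norm_Pair)
  have "(snd z / r)\<^sup>2 + (fst z / r)\<^sup>2 = 1"
    unfolding power_divide add_divide_distrib[symmetric] add.commute[of "(snd z)\<^sup>2"] r2[symmetric]
    using r by simp
  then obtain \<alpha> where "snd z / r = cos \<alpha>" "fst z / r = sin \<alpha>"
    using sincos_total_2pi by blast
  then have z: "fst z = r * sin \<alpha>" "snd z = r * cos \<alpha>" using r by (auto simp: field_simps)
  define Z where "Z = (\<lambda>u. u - \<alpha>) ` {u \<in> {\<alpha>..\<alpha> + pi}. sin u = 0}"
  have Z: "finite Z" unfolding Z_def by (intro finite_imageI finite_sin_zeros)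
  define f where "f \<theta> = - ln r - logsin (\<theta> + \<alpha>) + logsin (\<theta> + 0)
      + ((shear \<theta> x)\<^sup>2 + (shear \<theta> y)\<^sup>2) / 2" for \<theta>
  define I where "I = - ln r * 1 - cos (2 * \<alpha>) / 2 + cos (2 * 0) / 2 + ((norm x)\<^sup>2 / 2 + (norm y)\<^sup>2 / 2)"
  have "(\<integral>\<^sup>+ \<theta>. log_kernel (shear \<theta> x) (shear \<theta> y) \<partial>angle_measure) = ennreal I"
  proof (rule nn_integral_angle[OF _ Z])
    fix \<theta> assume \<theta>: "0 < \<theta>" "\<theta> < pi" "\<theta> \<notin> Z"
    have s: "sin \<theta> > 0" using \<theta> by (intro sin_gt_zero)
    have s\<alpha>: "sin (\<theta> + \<alpha>) \<noteq> 0"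
    proof
      assume "sin (\<theta> + \<alpha>) = 0"
      then have "\<theta> \<in> Z" unfolding Z_def using \<theta> by (intro image_eqI[of _ _ "\<theta> + \<alpha>"]) auto
      with \<theta> show False by simp
    qed
    have "sin \<theta> * (shear \<theta> x - shear \<theta> y) = sin \<theta> * shear \<theta> z"
      by (simp add: shear_def z_def left_diff_distrib diff_divide_distrib)
    also have "\<dots> = r * sin (\<theta> + \<alpha>)"
      using s unfolding sin_shear[of \<theta> z, OF less_imp_neq[OF s, symmetric]] z sin_add by (simp add: algebra_simps)
    finally have d: "shear \<theta> x - shear \<theta> y = r * sin (\<theta> + \<alpha>) / sin \<theta>"
      by (simp only: nonzero_eq_divide_eq[OF less_imp_neq[OF s, symmetric]] mult.commute[of _ "sin \<theta>"])
    then have ne: "shear \<theta> x \<noteq> shear \<theta> y" using r s s\<alpha> by auto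
    have "- ln \<bar>shear \<theta> x - shear \<theta> y\<bar> = - ln r - logsin (\<theta> + \<alpha>) + logsin (\<theta> + 0)"
      unfolding d logsin_def using r s s\<alpha> by (simp add: abs_mult ln_mult ln_div)
    then have "f \<theta> = - ln \<bar>shear \<theta> x - shear \<theta> y\<bar> + ((shear \<theta> x)\<^sup>2 + (shear \<theta> y)\<^sup>2) / 2"
      by (simp add: f_def)
    then show "0 \<le> f \<theta> \<and> log_kernel (shear \<theta> x) (shear \<theta> y) = ennreal (f \<theta>)"
      using log_kernel_nonneg[OF ne] ne by (simp add: log_kernel_def)
  next
    have "((\<lambda>\<theta>. - ln r * (2 / pi * (sin \<theta>)\<^sup>2) - 2 / pi * (sin \<theta>)\<^sup>2 * logsin (\<theta> + \<alpha>)
        + 2 / pi * (sin \<theta>)\<^sup>2 * logsin (\<theta> + 0)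
        + ((snd x * sin \<theta> + fst x * cos \<theta>)\<^sup>2 / pi + (snd y * sin \<theta> + fst y * cos \<theta>)\<^sup>2 / pi)) has_integral I) {0..pi}"
      unfolding I_def
      by (intro has_integral_add has_integral_diff has_integral_mult_right sin_square_has_integral
          sin_square_logsin_shift shear_square_has_integral)
    then show "((\<lambda>\<theta>. 2 / pi * (sin \<theta>)\<^sup>2 * f \<theta>) has_integral I) {0..pi}"
    proof (rule has_integral_spike_finite[OF finite_sin_zeros[of 0 pi], rotated])
      fix \<theta> assume "\<theta> \<in> {0..pi} - {\<theta> \<in> {0..pi}. sin \<theta> = 0}"
      then have s: "sin \<theta> \<noteq> 0" by auto
      have "2 / pi * (sin \<theta>)\<^sup>2 * f \<theta> = - ln r * (2 / pi * (sin \<theta>)\<^sup>2)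
          - 2 / pi * (sin \<theta>)\<^sup>2 * logsin (\<theta> + \<alpha>) + 2 / pi * (sin \<theta>)\<^sup>2 * logsin (\<theta> + 0)
          + ((sin \<theta> * shear \<theta> x)\<^sup>2 / pi + (sin \<theta> * shear \<theta> y)\<^sup>2 / pi)"
        unfolding f_def by (simp add: field_simps)
      then show "2 / pi * (sin \<theta>)\<^sup>2 * f \<theta> = - ln r * (2 / pi * (sin \<theta>)\<^sup>2)
          - 2 / pi * (sin \<theta>)\<^sup>2 * logsin (\<theta> + \<alpha>) + 2 / pi * (sin \<theta>)\<^sup>2 * logsin (\<theta> + 0)
          + ((snd x * sin \<theta> + fst x * cos \<theta>)\<^sup>2 / pi + (snd y * sin \<theta> + fst y * cos \<theta>)\<^sup>2 / pi)"
        unfolding sin_shear[OF s] .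
    qed
  qed measurable
  also have "ennreal I = e2ennreal (energy_density x y)"
  proof -
    have "I = - ln r + (fst z)\<^sup>2 / r\<^sup>2 + 1 / 2 * ((norm x)\<^sup>2 + (norm y)\<^sup>2)"
      unfolding I_def z cos_double_sin using r by (simp add: power_mult_distrib field_simps)
    then show ?thesis
      using False by (simp add: energy_density_def V_def r_def z_def)
  qed
  finally show ?thesis by simp
qed

section \<open>The semicircle law and its logarithmic potential\<close>

definition semicircle :: "real measure" where
  "semicircle = density lborel
     (\<lambda>t. ennreal (1 / pi * sqrt (2 - t\<^sup>2)) * indicator {- sqrt 2<..<sqrt 2} t)"

lemma sets_semicircle [simp, measurable_cong]: "sets semicircle = sets borel"
  by (simp add: semicircle_def)

text \<open>
  The substitution \<open>t = - \<surd>2 cos \<theta>\<close> turns the semicircle density into the density of the angle: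
  the potential of the law and the mean over projections are integrals against the same weight.
\<close>

lemma nn_integral_semicircle:
  assumes [measurable]: "g \<in> borel_measurable borel"
  shows "(\<integral>\<^sup>+ t. g t \<partial>semicircle) = (\<integral>\<^sup>+ \<theta>. g (- (sqrt 2 * cos \<theta>)) \<partial>angle_measure)"
proof -
  let ?f = "\<lambda>t. ennreal (1 / pi * sqrt (2 - t\<^sup>2)) * g t"
  have "(\<integral>\<^sup>+ t. g t \<partial>semicircle)
      = (\<integral>\<^sup>+ t. ennreal (1 / pi * sqrt (2 - t\<^sup>2)) * indicator {- sqrt 2<..<sqrt 2} t * g t \<partial>lborel)"
    unfolding semicircle_def by (rule nn_integral_density) measurable
  also have "\<dots> = (\<integral>\<^sup>+ t. ?f t * indicator {- (sqrt 2 * cos 0)..- (sqrt 2 * cos pi)} t \<partial>lborel)"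
  proof (rule nn_integral_cong)
    fix t :: real
    have "t = - sqrt 2 \<or> t = sqrt 2 \<Longrightarrow> 2 - t\<^sup>2 = 0" by auto
    then show "ennreal (1 / pi * sqrt (2 - t\<^sup>2)) * indicator {- sqrt 2<..<sqrt 2} t * g t
        = ?f t * indicator {- (sqrt 2 * cos 0)..- (sqrt 2 * cos pi)} t"
      by (cases "t = - sqrt 2 \<or> t = sqrt 2") (auto simp: indicator_def)
  qed
  also have "\<dots> = (\<integral>\<^sup>+ \<theta>. ?f (- (sqrt 2 * cos \<theta>)) * ennreal (sqrt 2 * sin \<theta>) * indicator {0..pi} \<theta> \<partial>lborel)"
    by (rule nn_integral_substitution_aux)
      (auto intro!: derivative_eq_intros continuous_intros mult_nonneg_nonneg sin_ge_zero)
  also have "\<dots> = (\<integral>\<^sup>+ \<theta>. ennreal (2 / pi * (sin \<theta>)\<^sup>2) * indicator {0<..<pi} \<theta> * g (- (sqrt 2 * cos \<theta>)) \<partial>lborel)"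
  proof (rule nn_integral_cong)
    fix \<theta> :: real
    show "?f (- (sqrt 2 * cos \<theta>)) * ennreal (sqrt 2 * sin \<theta>) * indicator {0..pi} \<theta>
        = ennreal (2 / pi * (sin \<theta>)\<^sup>2) * indicator {0<..<pi} \<theta> * g (- (sqrt 2 * cos \<theta>))"
    proof (cases "0 < \<theta> \<and> \<theta> < pi")
      case True
      then have s: "sin \<theta> > 0" by (intro sin_gt_zero) auto
      have ac: "a * b * c = a * c * b" for a b c :: ennreal by (simp only: ac_simps)
      have "2 - (- (sqrt 2 * cos \<theta>))\<^sup>2 = 2 * (sin \<theta>)\<^sup>2"
        by (simp add: power_mult_distrib sin_squared_eq)
      then have "sqrt (2 - (- (sqrt 2 * cos \<theta>))\<^sup>2) = sqrt 2 * sin \<theta>"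
        using s by (simp add: real_sqrt_mult)
      then have "ennreal (1 / pi * sqrt (2 - (- (sqrt 2 * cos \<theta>))\<^sup>2)) * ennreal (sqrt 2 * sin \<theta>)
          = ennreal (2 / pi * (sin \<theta>)\<^sup>2)"
        using s by (simp add: power2_eq_square flip: ennreal_mult')
      then have "?f (- (sqrt 2 * cos \<theta>)) * ennreal (sqrt 2 * sin \<theta>)
          = ennreal (2 / pi * (sin \<theta>)\<^sup>2) * g (- (sqrt 2 * cos \<theta>))"
        by (subst ac) (simp only:)
      then show ?thesis using True by (simp only: indicator_simps(1)[of \<theta>] greaterThanLessThan_iff atLeastAtMost_iff less_imp_le mult_1_right simp_thms)
    next
      case False
      then show ?thesis by (auto simp: indicator_def)
    qed
  qed
  also have "\<dots> = (\<integral>\<^sup>+ \<theta>. g (- (sqrt 2 * cos \<theta>)) \<partial>angle_measure)"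
    unfolding angle_measure_def by (rule nn_integral_density[symmetric]) measurable
  finally show ?thesis .
qed

lemma prob_space_semicircle: "prob_space semicircle"
  using nn_integral_semicircle[of "\<lambda>_. 1"] prob_space.emeasure_space_1[OF prob_space_angle]
  by (intro prob_spaceI) simp

lemma sin_cos_square_has_integral:
  "((\<lambda>\<theta>. 2 / pi * (sin \<theta>)\<^sup>2 * (cos \<theta>)\<^sup>2) has_integral 1 / 4) {0..pi}"
proof -
  have "((\<lambda>\<theta>. (1 - cos (4 * \<theta>)) / 4) has_integral
      ((pi - sin (4 * pi) / 4) / 4 - (0 - sin (4 * 0) / 4) / 4)) {0..pi}"
    by (rule fundamental_theorem_of_calculus)
      (auto intro!: derivative_eq_intros simp flip: has_real_derivative_iff_has_vector_derivative)
  moreover have "sin (4 * pi) = 0" by (simp add: sin_cos_quadruple)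
  ultimately have "((\<lambda>\<theta>. 1 / pi * ((1 - cos (4 * \<theta>)) / 4)) has_integral 1 / pi * (pi / 4)) {0..pi}"
    by (intro has_integral_mult_right) simp
  moreover have "1 / pi * ((1 - cos (4 * \<theta>)) / 4) = 2 / pi * (sin \<theta>)\<^sup>2 * (cos \<theta>)\<^sup>2" for \<theta>
    unfolding sin_cos_quadruple sin_squared_eq by (simp add: power2_eq_square power4_eq_xxxx field_simps)
  ultimately show ?thesis by simp
qed

lemma semicircle_second_moment: "(\<integral>\<^sup>+ t. ennreal (t\<^sup>2) \<partial>semicircle) = ennreal (1 / 2)"
proof -
  have "(\<integral>\<^sup>+ \<theta>. ennreal ((- (sqrt 2 * cos \<theta>))\<^sup>2) \<partial>angle_measure) = ennreal (1 / 2)"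
  proof (rule nn_integral_angle[where Z = "{}" and f = "\<lambda>\<theta>. 2 * (cos \<theta>)\<^sup>2"])
    show "((\<lambda>\<theta>. 2 / pi * (sin \<theta>)\<^sup>2 * (2 * (cos \<theta>)\<^sup>2)) has_integral 1 / 2) {0..pi}"
      using has_integral_mult_right[OF sin_cos_square_has_integral, of 2] by (simp add: ac_simps)
  qed (auto simp: power_mult_distrib)
  then show ?thesis by (subst nn_integral_semicircle) auto
qed

text \<open>
  The two terms are exchanged by \<open>\<theta> \<mapsto> - \<theta>\<close>, so the integral is that of the first term over \<open>[-\<pi>, \<pi>]\<close>.
  With \<open>u = (\<theta> + \<alpha>) / 2\<close> this is one period of \<^const>\<open>logsin\<close>, against \<open>1 - cos (4u - 2\<alpha>)\<close>.
\<close>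

lemma sin_square_logsin_pair:
  "((\<lambda>\<theta>. 2 / pi * (sin \<theta>)\<^sup>2 * (logsin ((\<theta> + \<alpha>) / 2) + logsin ((\<theta> - \<alpha>) / 2)))
     has_integral cos (2 * \<alpha>) / 2) {0..pi}"
proof -
  define q where "q \<theta> = 2 / pi * (sin \<theta>)\<^sup>2 * logsin ((\<theta> + \<alpha>) / 2)" for \<theta>
  let ?h = "\<lambda>u. 1 / pi * (logsin u - cos (2 * \<alpha>) * (cos (4 * u) * logsin u)
      - sin (2 * \<alpha>) * (sin (4 * u) * logsin u))"
  have "(?h has_integral 1 / pi * (0 - cos (2 * \<alpha>) * (- pi / 4) - sin (2 * \<alpha>) * 0)) {(\<alpha> - pi) / 2..(\<alpha> - pi) / 2 + pi}"
    by (intro has_integral_mult_right has_integral_diff logsin_period logsin_cos4_period logsin_sin4_period)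
  then have "(?h has_integral cos (2 * \<alpha>) / 4) (cbox ((\<alpha> - pi) / 2) ((\<alpha> + pi) / 2))"
    by (simp add: field_simps)
  from has_integral_affinity'[OF this, of "1 / 2" "\<alpha> / 2"]
  have "((\<lambda>\<theta>. ?h (1 / 2 * \<theta> + \<alpha> / 2)) has_integral cos (2 * \<alpha>) / 2) {- pi..pi}"
    by (simp add: field_simps)
  moreover have "?h (1 / 2 * \<theta> + \<alpha> / 2) = q \<theta>" for \<theta>
  proof -
    define u where "u = (\<theta> + \<alpha>) / 2"
    have "4 * u - 2 * \<alpha> = 2 * \<theta>" by (simp add: u_def field_simps)
    then have "cos (2 * \<theta>) = cos (4 * u - 2 * \<alpha>)" by simp
    also have "\<dots> = cos (2 * \<alpha>) * cos (4 * u) + sin (2 * \<alpha>) * sin (4 * u)"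
      by (simp only: cos_diff mult.commute)
    finally have "2 * (sin \<theta>)\<^sup>2 = 1 - (cos (2 * \<alpha>) * cos (4 * u) + sin (2 * \<alpha>) * sin (4 * u))"
      using cos_double_sin[of \<theta>] by linarith
    then have "q \<theta> = 1 / pi * ((1 - (cos (2 * \<alpha>) * cos (4 * u) + sin (2 * \<alpha>) * sin (4 * u))) * logsin u)"
      by (simp add: q_def u_def)
    moreover have "1 / 2 * \<theta> + \<alpha> / 2 = u" by (simp add: u_def add_divide_distrib)
    ultimately show ?thesis by (simp add: algebra_simps diff_divide_distrib add_divide_distrib)
  qed
  ultimately have q: "(q has_integral cos (2 * \<alpha>) / 2) {- pi..pi}" by simp
  then have i: "q integrable_on {- pi..0}" "q integrable_on {0..pi}"
    by (auto intro: integrable_on_subinterval)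
  have "(q has_integral integral {- pi..0} q) {- pi..0}" using i by blast
  then have "((\<lambda>\<theta>. q (- \<theta>)) has_integral integral {- pi..0} q) {0..pi}"
    using has_integral_reflect_real[of q "integral {- pi..0} q" 0 "- pi"] by simp
  moreover have "(q has_integral integral {0..pi} q) {0..pi}" using i by blast
  ultimately have "((\<lambda>\<theta>. q \<theta> + q (- \<theta>)) has_integral (integral {0..pi} q + integral {- pi..0} q)) {0..pi}"
    by (intro has_integral_add)
  also have "integral {0..pi} q + integral {- pi..0} q = cos (2 * \<alpha>) / 2"
    using Henstock_Kurzweil_Integration.integral_combine[of "- pi" 0 pi q] q by (simp add: has_integral_integrable_integral)
  also have "(\<lambda>\<theta>. q \<theta> + q (- \<theta>))
      = (\<lambda>\<theta>. 2 / pi * (sin \<theta>)\<^sup>2 * (logsin ((\<theta> + \<alpha>) / 2) + logsin ((\<theta> - \<alpha>) / 2)))"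
  proof
    fix \<theta>
    have "(- \<theta> + \<alpha>) / 2 = - ((\<theta> - \<alpha>) / 2)" by (simp add: field_simps)
    then have "logsin ((- \<theta> + \<alpha>) / 2) = logsin ((\<theta> - \<alpha>) / 2)" by (simp only: logsin_minus)
    then have "q (- \<theta>) = 2 / pi * (sin \<theta>)\<^sup>2 * logsin ((\<theta> - \<alpha>) / 2)" by (simp only: q_def sin_minus power2_minus)
    then show "q \<theta> + q (- \<theta>) = 2 / pi * (sin \<theta>)\<^sup>2 * (logsin ((\<theta> + \<alpha>) / 2) + logsin ((\<theta> - \<alpha>) / 2))"
      by (simp only: q_def distrib_left)
  qed
  finally show ?thesis .
qed

text \<open>
  For \<open>s = - \<surd>2 cos \<alpha>\<close> and \<open>t = - \<surd>2 cos \<theta>\<close> the distance factors,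
  \<open>|s - t| = |2 sin ((\<theta> + \<alpha>) / 2)| |2 sin ((\<theta> - \<alpha>) / 2)| / \<surd>2\<close>, and the mean of its logarithm is
  \<open>(cos 2\<alpha> - ln 2) / 2\<close>. The term in \<open>\<alpha>\<close> cancels \<open>s\<^sup>2 / 2 = cos\<^sup>2 \<alpha>\<close> up to a constant.
\<close>

lemma semicircle_potential_inside:
  assumes s: "\<bar>s\<bar> \<le> sqrt 2"
  shows "(\<integral>\<^sup>+ t. log_kernel s t \<partial>semicircle) = ennreal (3 / 4 + ln 2 / 2)"
proof -
  define \<alpha> where "\<alpha> = arccos (- s / sqrt 2)"
  have b: "- 1 \<le> - s / sqrt 2" "- s / sqrt 2 \<le> 1" using s by (auto simp: field_simps)
  have \<alpha>: "0 \<le> \<alpha>" "\<alpha> \<le> pi" unfolding \<alpha>_def using b by (auto intro: arccos_lbound arccos_ubound)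
  have s_eq: "s = - (sqrt 2 * cos \<alpha>)" unfolding \<alpha>_def cos_arccos[OF b] by simp
  define f where "f \<theta> = ln 2 / 2 - (logsin ((\<theta> + \<alpha>) / 2) + logsin ((\<theta> - \<alpha>) / 2)) + (cos \<alpha>)\<^sup>2 + (cos \<theta>)\<^sup>2" for \<theta>
  have "(\<integral>\<^sup>+ \<theta>. log_kernel s (- (sqrt 2 * cos \<theta>)) \<partial>angle_measure) = ennreal (3 / 4 + ln 2 / 2)"
  proof (rule nn_integral_angle[where Z = "{\<alpha>}" and f = f])
    fix \<theta> assume \<theta>: "0 < \<theta>" "\<theta> < pi" "\<theta> \<notin> {\<alpha>}"
    define t where "t = - (sqrt 2 * cos \<theta>)"
    have A: "sin ((\<theta> + \<alpha>) / 2) \<noteq> 0" using sin_gt_zero[of "(\<theta> + \<alpha>) / 2"] \<theta> \<alpha> by auto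
    have B: "sin ((\<theta> - \<alpha>) / 2) \<noteq> 0"
      using sin_gt_zero[of "(\<theta> - \<alpha>) / 2"] sin_gt_zero[of "(\<alpha> - \<theta>) / 2"] sin_minus[of "(\<theta> - \<alpha>) / 2"] \<theta> \<alpha>
      by (cases \<theta> \<alpha> rule: linorder_cases) (auto simp: minus_divide_left)
    have "s - t = sqrt 2 * (cos \<theta> - cos \<alpha>)" by (simp add: s_eq t_def algebra_simps)
    also have "cos \<theta> - cos \<alpha> = - 2 * sin ((\<theta> + \<alpha>) / 2) * sin ((\<theta> - \<alpha>) / 2)"
      using cos_diff_cos[of \<theta> \<alpha>] sin_minus[of "(\<theta> - \<alpha>) / 2"] by (simp add: minus_divide_left)
    finally have d: "s - t = - (sqrt 2 * (2 * sin ((\<theta> + \<alpha>) / 2)) * (2 * sin ((\<theta> - \<alpha>) / 2)) / 2)"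
      by simp
    then have ne: "s \<noteq> t" using A B by auto
    have "ln \<bar>s - t\<bar> = ln (sqrt 2) + logsin ((\<theta> + \<alpha>) / 2) + logsin ((\<theta> - \<alpha>) / 2) - ln 2"
      unfolding d logsin_def using A B by (simp only: abs_minus_cancel abs_mult abs_divide) (simp add: ln_mult ln_div abs_mult)
    then have "f \<theta> = - ln \<bar>s - t\<bar> + (s\<^sup>2 + t\<^sup>2) / 2"
      by (simp add: f_def s_eq t_def power_mult_distrib ln_sqrt)
    then show "0 \<le> f \<theta> \<and> log_kernel s (- (sqrt 2 * cos \<theta>)) = ennreal (f \<theta>)"
      using log_kernel_nonneg[OF ne] ne unfolding t_def[symmetric] by (simp add: log_kernel_def)
  next
    have "((\<lambda>\<theta>. ln 2 / 2 * (2 / pi * (sin \<theta>)\<^sup>2)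
        - 2 / pi * (sin \<theta>)\<^sup>2 * (logsin ((\<theta> + \<alpha>) / 2) + logsin ((\<theta> - \<alpha>) / 2))
        + (cos \<alpha>)\<^sup>2 * (2 / pi * (sin \<theta>)\<^sup>2) + 2 / pi * (sin \<theta>)\<^sup>2 * (cos \<theta>)\<^sup>2) has_integral
        (ln 2 / 2 * 1 - cos (2 * \<alpha>) / 2 + (cos \<alpha>)\<^sup>2 * 1 + 1 / 4)) {0..pi}"
      by (intro has_integral_add has_integral_diff has_integral_mult_right sin_square_has_integral
          sin_square_logsin_pair sin_cos_square_has_integral)
    moreover have "ln 2 / 2 * 1 - cos (2 * \<alpha>) / 2 + (cos \<alpha>)\<^sup>2 * 1 + 1 / 4 = 3 / 4 + ln 2 / 2"
      unfolding cos_double_cos by (simp add: field_simps)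
    moreover have "ln 2 / 2 * (2 / pi * (sin \<theta>)\<^sup>2)
        - 2 / pi * (sin \<theta>)\<^sup>2 * (logsin ((\<theta> + \<alpha>) / 2) + logsin ((\<theta> - \<alpha>) / 2))
        + (cos \<alpha>)\<^sup>2 * (2 / pi * (sin \<theta>)\<^sup>2) + 2 / pi * (sin \<theta>)\<^sup>2 * (cos \<theta>)\<^sup>2
        = 2 / pi * (sin \<theta>)\<^sup>2 * f \<theta>" for \<theta>
      unfolding f_def by (simp add: algebra_simps)
    ultimately show "((\<lambda>\<theta>. 2 / pi * (sin \<theta>)\<^sup>2 * f \<theta>) has_integral 3 / 4 + ln 2 / 2) {0..pi}"
      by (simp only:)
  qed auto
  then show ?thesis by (subst nn_integral_semicircle) auto
qed

text \<open>
  The function \<open>1 / (\<surd>2 - \<epsilon> t)\<close> is integrable for the semicircle law, since the density vanishes at the edges: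
  its singularity is cancelled by \<open>sin\<^sup>2 \<theta> = (1 - \<epsilon> cos \<theta>) (1 + \<epsilon> cos \<theta>)\<close>.
\<close>

lemma semicircle_resolvent_edge:
  assumes \<epsilon>: "\<epsilon> = 1 \<or> \<epsilon> = - 1"
  shows "(\<integral>\<^sup>+ \<theta>. ennreal (1 / (sqrt 2 + \<epsilon> * (sqrt 2 * cos \<theta>))) \<partial>angle_measure) = ennreal (sqrt 2)"
proof (rule nn_integral_angle[where Z = "{}" and f = "\<lambda>\<theta>. 1 / (sqrt 2 + \<epsilon> * (sqrt 2 * cos \<theta>))"])
  have c: "0 < 1 + \<epsilon> * cos \<theta>" if "0 < \<theta>" "\<theta> < pi" for \<theta>
    using \<epsilon> that cos_monotone_0_pi[of 0 \<theta>] cos_monotone_0_pi[of \<theta> pi] by auto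
  have fac: "sqrt 2 + \<epsilon> * (sqrt 2 * cos \<theta>) = sqrt 2 * (1 + \<epsilon> * cos \<theta>)" for \<theta>
    by (simp add: algebra_simps)
  show "0 \<le> 1 / (sqrt 2 + \<epsilon> * (sqrt 2 * cos \<theta>)) \<and>
      ennreal (1 / (sqrt 2 + \<epsilon> * (sqrt 2 * cos \<theta>))) = ennreal (1 / (sqrt 2 + \<epsilon> * (sqrt 2 * cos \<theta>)))"
    if "0 < \<theta>" "\<theta> < pi" for \<theta>
    unfolding fac using c[OF that] by simp
  have "((\<lambda>\<theta>. 1 - \<epsilon> * cos \<theta>) has_integral ((pi - \<epsilon> * sin pi) - (0 - \<epsilon> * sin 0))) {0..pi}"
    by (rule fundamental_theorem_of_calculus)
      (auto intro!: derivative_eq_intros simp flip: has_real_derivative_iff_has_vector_derivative)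
  from has_integral_mult_right[OF this, of "sqrt 2 / pi"]
  have "((\<lambda>\<theta>. sqrt 2 / pi * (1 - \<epsilon> * cos \<theta>)) has_integral sqrt 2) {0..pi}" by simp
  then show "((\<lambda>\<theta>. 2 / pi * (sin \<theta>)\<^sup>2 * (1 / (sqrt 2 + \<epsilon> * (sqrt 2 * cos \<theta>)))) has_integral sqrt 2) {0..pi}"
  proof (rule has_integral_spike_finite[of "{0, pi}", rotated 2])
    fix \<theta> assume "\<theta> \<in> {0..pi} - {0, pi}"
    then have p: "0 < 1 + \<epsilon> * cos \<theta>" by (intro c) auto
    have sq: "(sin \<theta>)\<^sup>2 = (1 - \<epsilon> * cos \<theta>) * (1 + \<epsilon> * cos \<theta>)"
      using \<epsilon> by (auto simp: sin_squared_eq power2_eq_square algebra_simps)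
    have key: "2 / pi * (a * b) * (1 / (r * b)) = r / pi * a" if "r * r = 2" "b > 0" for a b r :: real
    proof -
      have "2 / pi * (a * b) * (1 / (r * b)) = r * r / pi * (a * b) * (1 / (r * b))" by (simp only: that)
      moreover have "r \<noteq> 0" using that by auto
      then have "r * r / pi * (a * b) * (1 / (r * b)) = r / pi * a" using that(2) by (simp add: field_simps)
      ultimately show ?thesis by (rule trans)
    qed
    show "2 / pi * (sin \<theta>)\<^sup>2 * (1 / (sqrt 2 + \<epsilon> * (sqrt 2 * cos \<theta>))) = sqrt 2 / pi * (1 - \<epsilon> * cos \<theta>)"
      unfolding fac sq by (rule key) (use p in simp_all)
  qed simp
qed auto

text \<open>
  Compare \<open>s\<close> with the nearest edge \<open>s\<^sub>0\<close> of the support. By \<open>ln (1 + a) \<le> a\<close> the mean of \<open>ln |s - t|\<close> grows by at most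
  \<open>(|s| - \<surd>2)\<close> times the resolvent at the edge, i.e. by \<open>(|s| - \<surd>2) \<surd>2\<close>, while the quadratic
  term gains \<open>(s\<^sup>2 - 2) / 2\<close>. The gain wins because \<open>(|s| - \<surd>2)\<^sup>2 \<ge> 0\<close>.
\<close>

lemma semicircle_potential_outside:
  assumes s: "\<bar>s\<bar> > sqrt 2"
  shows "ennreal (3 / 4 + ln 2 / 2) \<le> (\<integral>\<^sup>+ t. log_kernel s t \<partial>semicircle)"
proof -
  define \<epsilon> where "\<epsilon> = sgn s"
  have s0: "s \<noteq> 0" using s by auto
  have \<epsilon>: "\<epsilon> = 1 \<or> \<epsilon> = - 1" using s0 by (auto simp: \<epsilon>_def sgn_if)
  define u where "u = \<bar>s\<bar>"
  have su: "s = \<epsilon> * u" by (simp add: \<epsilon>_def u_def sgn_mult_abs)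
  have u: "u > sqrt 2" using s by (simp add: u_def)
  have ss: "s\<^sup>2 = u\<^sup>2" by (simp add: u_def)
  let ?w = "(u - sqrt 2) * sqrt 2"
  have u2: "?w \<le> (u\<^sup>2 - 2) / 2"
    using zero_le_power2[of "u - sqrt 2"] by (simp add: power2_eq_square algebra_simps)
  have w: "0 \<le> ?w" using u by simp
  have "ennreal ?w + ennreal (3 / 4 + ln 2 / 2) \<le> ennreal ((u\<^sup>2 - 2) / 2) + ennreal (3 / 4 + ln 2 / 2)"
    by (intro add_right_mono ennreal_leI u2)
  also have "\<dots> = (\<integral>\<^sup>+ \<theta>. ennreal ((u\<^sup>2 - 2) / 2) + log_kernel (\<epsilon> * sqrt 2) (- (sqrt 2 * cos \<theta>)) \<partial>angle_measure)"
    using semicircle_potential_inside[of "\<epsilon> * sqrt 2"] \<epsilon> prob_space.emeasure_space_1[OF prob_space_angle]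
    by (subst nn_integral_add) (auto simp: nn_integral_semicircle)
  also have "\<dots> \<le> (\<integral>\<^sup>+ \<theta>. ennreal (u - sqrt 2) * ennreal (1 / (sqrt 2 + \<epsilon> * (sqrt 2 * cos \<theta>)))
      + log_kernel s (- (sqrt 2 * cos \<theta>)) \<partial>angle_measure)"
  proof (rule nn_integral_mono_AE, unfold AE_angle, rule AE_I2, rule impI)
    fix \<theta> assume "\<theta> \<in> {0<..<pi}"
    then have \<theta>: "0 < \<theta>" "\<theta> < pi" by auto
    define t where "t = - (sqrt 2 * cos \<theta>)"
    define d where "d = sqrt 2 - \<epsilon> * t"
    have "cos \<theta> < 1" "- 1 < cos \<theta>"
      using \<theta> cos_monotone_0_pi[of 0 \<theta>] cos_monotone_0_pi[of \<theta> pi] by auto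
    then have "0 < sqrt 2 * (1 + \<epsilon> * cos \<theta>)" using \<epsilon> by auto
    then have d: "d > 0" by (simp add: d_def t_def algebra_simps)
    have abs: "\<bar>\<epsilon> * x - t\<bar> = \<bar>x - \<epsilon> * t\<bar>" for x using \<epsilon> by auto
    have dist: "\<bar>s - t\<bar> = d + (u - sqrt 2)" "\<bar>\<epsilon> * sqrt 2 - t\<bar> = d"
      unfolding su abs using d u by (auto simp: d_def)
    have ne: "s \<noteq> t" "\<epsilon> * sqrt 2 \<noteq> t" using dist d u by auto
    have "ln (1 + (u - sqrt 2) / d) \<le> (u - sqrt 2) / d"
      using u d by (intro ln_add_one_self_le_self) simp
    also have "1 + (u - sqrt 2) / d = (d + (u - sqrt 2)) / d" using d by (simp add: field_simps)
    finally have l: "ln (d + (u - sqrt 2)) - ln d \<le> (u - sqrt 2) * (1 / d)"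
      using d u by (simp add: ln_div)
    have "ennreal ((u\<^sup>2 - 2) / 2) + log_kernel (\<epsilon> * sqrt 2) t
        = ennreal ((u\<^sup>2 - 2) / 2 + (- ln d + ((\<epsilon> * sqrt 2)\<^sup>2 + t\<^sup>2) / 2))"
      using log_kernel_nonneg[OF ne(2)] ne w u2 unfolding log_kernel_def dist
      by (subst ennreal_plus) auto
    also have "\<dots> \<le> ennreal ((u - sqrt 2) * (1 / d) + (- ln (d + (u - sqrt 2)) + (s\<^sup>2 + t\<^sup>2) / 2))"
    proof (rule ennreal_leI)
      have "(\<epsilon> * sqrt 2)\<^sup>2 = 2" using \<epsilon> by auto
      then show "(u\<^sup>2 - 2) / 2 + (- ln d + ((\<epsilon> * sqrt 2)\<^sup>2 + t\<^sup>2) / 2)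
          \<le> (u - sqrt 2) * (1 / d) + (- ln (d + (u - sqrt 2)) + (s\<^sup>2 + t\<^sup>2) / 2)"
        using l unfolding ss by (simp add: add_divide_distrib diff_divide_distrib)
    qed
    also have "\<dots> = ennreal (u - sqrt 2) * ennreal (1 / d) + log_kernel s t"
      using log_kernel_nonneg[OF ne(1)] ne u d unfolding log_kernel_def dist
      by (subst ennreal_plus) (auto simp flip: ennreal_mult')
    finally show "ennreal ((u\<^sup>2 - 2) / 2) + log_kernel (\<epsilon> * sqrt 2) (- (sqrt 2 * cos \<theta>))
        \<le> ennreal (u - sqrt 2) * ennreal (1 / (sqrt 2 + \<epsilon> * (sqrt 2 * cos \<theta>)))
          + log_kernel s (- (sqrt 2 * cos \<theta>))"
      by (simp add: d_def t_def)
  qed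
  also have "\<dots> = ennreal ?w + (\<integral>\<^sup>+ t. log_kernel s t \<partial>semicircle)"
    using semicircle_resolvent_edge[OF \<epsilon>] u
    by (simp add: nn_integral_add nn_integral_cmult nn_integral_semicircle ennreal_mult')
  finally show ?thesis
    by (subst (asm) ennreal_add_left_cancel_le) auto
qed

lemma semicircle_potential_ge:
  "ennreal (3 / 4 + ln 2 / 2) \<le> (\<integral>\<^sup>+ t. log_kernel s t \<partial>semicircle)"
  using semicircle_potential_inside[of s] semicircle_potential_outside[of s] by force

lemma log_energy_semicircle: "log_energy semicircle semicircle = ennreal (3 / 4 + ln 2 / 2)"
proof -
  interpret prob_space semicircle by (rule prob_space_semicircle)
  have "log_energy semicircle semicircle
      = (\<integral>\<^sup>+ \<theta>. \<integral>\<^sup>+ t. log_kernel (- (sqrt 2 * cos \<theta>)) t \<partial>semicircle \<partial>angle_measure)"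
    unfolding log_energy_def by (rule nn_integral_semicircle) measurable
  also have "\<dots> = (\<integral>\<^sup>+ \<theta>. ennreal (3 / 4 + ln 2 / 2) \<partial>angle_measure)"
    by (intro nn_integral_cong semicircle_potential_inside) (simp add: abs_mult mult_left_le)
  also have "\<dots> = ennreal (3 / 4 + ln 2 / 2)"
    by (rule nn_integral_angle_const)
  finally show ?thesis .
qed

text \<open>
  The mixed energy with the semicircle law is a mean of its potential, hence at least \<open>3/4 + (ln 2)/2\<close>, the energy
  of the semicircle law itself. Insert this into the positive definiteness inequality.
\<close>

lemma log_energy_ge:
  fixes \<nu> :: "real measure"
  assumes \<nu>: "prob_space \<nu>" "sets \<nu> = sets borel"
  shows "window_distance \<nu> semicircle + ennreal (3 / 4 + ln 2 / 2) \<le> log_energy \<nu> \<nu>"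
proof -
  interpret prob_space \<nu> by (rule \<nu>)
  let ?e = "ennreal (3 / 4 + ln 2 / 2)"
  have "?e = (\<integral>\<^sup>+ s. ?e \<partial>\<nu>)" by (simp add: emeasure_space_1)
  also have "\<dots> \<le> log_energy \<nu> semicircle"
    unfolding log_energy_def by (intro nn_integral_mono semicircle_potential_ge)
  finally have "window_distance \<nu> semicircle + 2 * ?e \<le> window_distance \<nu> semicircle + 2 * log_energy \<nu> semicircle"
    by (intro add_left_mono mult_left_mono) auto
  also have "\<dots> \<le> log_energy \<nu> \<nu> + ?e"
    using log_energy_inequality[OF \<nu>(1) prob_space_semicircle \<nu>(2) sets_semicircle] log_energy_semicircle
    by simp
  finally have "?e + (window_distance \<nu> semicircle + ?e) \<le> ?e + log_energy \<nu> \<nu>"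
    by (simp only: mult_2 add_ac)
  then show ?thesis by (subst (asm) ennreal_add_left_cancel_le) auto
qed

section \<open>The semicircle law on the vertical axis\<close>

lemma m1_eq: "m\<^sub>1 = return borel 0 \<Otimes>\<^sub>M semicircle"
  by (simp add: m\<^sub>1_def semicircle_def)

lemma sets_m1 [simp, measurable_cong]: "sets m\<^sub>1 = sets borel"
proof -
  have "sets m\<^sub>1 = sets (borel \<Otimes>\<^sub>M borel :: plane measure)"
    unfolding m1_eq by (intro sets_pair_measure_cong) simp_all
  then show ?thesis by (simp only: borel_prod)
qed

lemma axis_measurable [measurable]: "(\<lambda>t::real. (0::real, t)) \<in> borel \<rightarrow>\<^sub>M borel"
  by (intro borel_measurable_continuous_onI continuous_intros)

lemma nn_integral_m1:
  assumes g [measurable]: "g \<in> borel_measurable borel"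
  shows "(\<integral>\<^sup>+ x. g x \<partial>m\<^sub>1) = (\<integral>\<^sup>+ t. g (0, t) \<partial>semicircle)"
proof -
  interpret prob_space semicircle by (rule prob_space_semicircle)
  have "sets (return borel 0 \<Otimes>\<^sub>M semicircle) = sets (borel :: plane measure)"
    using sets_m1 by (simp only: m1_eq)
  with g have "g \<in> borel_measurable (return borel 0 \<Otimes>\<^sub>M semicircle)"
    by (subst measurable_cong_sets[OF _ refl])
  then have "(\<integral>\<^sup>+ x. g x \<partial>m\<^sub>1) = (\<integral>\<^sup>+ a. \<integral>\<^sup>+ t. g (a, t) \<partial>semicircle \<partial>return borel 0)"
    unfolding m1_eq by (rule nn_integral_fst[symmetric])
  also have "\<dots> = (\<integral>\<^sup>+ t. g (0, t) \<partial>semicircle)"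
  proof (rule nn_integral_return)
    have "g \<in> borel_measurable (borel \<Otimes>\<^sub>M borel)" using g by (simp add: borel_prod)
    then have [measurable]: "case_prod (\<lambda>a t. g (a, t)) \<in> borel_measurable (borel \<Otimes>\<^sub>M semicircle)" by simp
    show "(\<lambda>a. \<integral>\<^sup>+ t. g (a, t) \<partial>semicircle) \<in> borel_measurable borel" by measurable
  qed simp
  finally show ?thesis .
qed

lemma m1_distr: "m\<^sub>1 = distr semicircle borel (\<lambda>t. (0, t))"
proof (rule measure_eqI)
  fix A assume "A \<in> sets m\<^sub>1"
  then have A: "A \<in> sets borel" by simp
  then show "emeasure m\<^sub>1 A = emeasure (distr semicircle borel (\<lambda>t. (0, t))) A"
    using nn_integral_m1[of "indicator A"]
    by (simp add: nn_integral_distr flip: nn_integral_indicator)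
qed simp

lemma prob_space_m1: "prob_space m\<^sub>1"
  unfolding m1_distr by (rule prob_space.prob_space_distr[OF prob_space_semicircle]) measurable

lemma shear_m1: "distr m\<^sub>1 borel (shear \<theta>) = semicircle"
proof -
  have "distr m\<^sub>1 borel (shear \<theta>) = distr semicircle borel (shear \<theta> \<circ> (\<lambda>t. (0, t)))"
    unfolding m1_distr by (rule distr_distr) measurable
  also have "shear \<theta> \<circ> (\<lambda>t. (0, t)) = (\<lambda>t. t)" by (auto simp: shear_def)
  also have "distr semicircle borel (\<lambda>t. t) = semicircle" by (rule distr_id2) simp
  finally show ?thesis .
qed

lemma energy_density_measurable [measurable (raw)]:
  assumes [measurable]: "f \<in> M \<rightarrow>\<^sub>M borel" "g \<in> M \<rightarrow>\<^sub>M borel"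
  shows "(\<lambda>x. e2ennreal (energy_density (f x) (g x))) \<in> borel_measurable M"
proof -
  interpret prob_space angle_measure by (rule prob_space_angle)
  show ?thesis unfolding energy_density_mixture by measurable
qed

lemma potential_mixture:
  fixes \<mu> :: "plane measure"
  assumes \<mu>: "prob_space \<mu>" and [measurable_cong]: "sets \<mu> = sets borel"
  shows "(\<integral>\<^sup>+ y. e2ennreal (energy_density x y) \<partial>\<mu>)
    = (\<integral>\<^sup>+ \<theta>. \<integral>\<^sup>+ t. log_kernel (shear \<theta> x) t \<partial>distr \<mu> borel (shear \<theta>) \<partial>angle_measure)"
proof -
  interpret \<mu>: prob_space \<mu> by fact
  interpret A: prob_space angle_measure by (rule prob_space_angle)
  interpret pair_sigma_finite angle_measure \<mu> ..
  have "(\<integral>\<^sup>+ y. e2ennreal (energy_density x y) \<partial>\<mu>)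
      = (\<integral>\<^sup>+ \<theta>. \<integral>\<^sup>+ y. log_kernel (shear \<theta> x) (shear \<theta> y) \<partial>\<mu> \<partial>angle_measure)"
    unfolding energy_density_mixture by (rule Fubini') measurable
  also have "\<dots> = (\<integral>\<^sup>+ \<theta>. \<integral>\<^sup>+ t. log_kernel (shear \<theta> x) t \<partial>distr \<mu> borel (shear \<theta>) \<partial>angle_measure)"
    by (intro nn_integral_cong nn_integral_distr[symmetric]) measurable
  finally show ?thesis .
qed

lemma energy_mixture:
  fixes \<mu> :: "plane measure"
  assumes \<mu>: "prob_space \<mu>" and [measurable_cong]: "sets \<mu> = sets borel"
  defines "L \<equiv> \<lambda>\<theta>. log_energy (distr \<mu> borel (shear \<theta>)) (distr \<mu> borel (shear \<theta>))"
  shows "L \<in> borel_measurable borel" "energy \<mu> = (\<integral>\<^sup>+ \<theta>. L \<theta> \<partial>angle_measure)"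
proof -
  interpret \<mu>: prob_space \<mu> by fact
  interpret A: prob_space angle_measure by (rule prob_space_angle)
  interpret pair_sigma_finite angle_measure \<mu> ..
  have L: "L \<theta> = (\<integral>\<^sup>+ x. \<integral>\<^sup>+ y. log_kernel (shear \<theta> x) (shear \<theta> y) \<partial>\<mu> \<partial>\<mu>)" for \<theta>
  proof -
    interpret D: prob_space "distr \<mu> borel (shear \<theta>)" by (rule \<mu>.prob_space_distr) measurable
    show ?thesis
      unfolding L_def log_energy_def by (simp add: nn_integral_distr)
  qed
  then have L': "L = (\<lambda>\<theta>. \<integral>\<^sup>+ x. \<integral>\<^sup>+ y. log_kernel (shear \<theta> x) (shear \<theta> y) \<partial>\<mu> \<partial>\<mu>)" by auto
  show "L \<in> borel_measurable borel" unfolding L' by measurable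
  have "energy \<mu> = (\<integral>\<^sup>+ x. \<integral>\<^sup>+ y. e2ennreal (energy_density x y) \<partial>\<mu> \<partial>\<mu>)"
    unfolding energy_def by (subst \<mu>.nn_integral_fst[symmetric]) (auto simp: split_beta')
  also have "\<dots> = (\<integral>\<^sup>+ x. \<integral>\<^sup>+ \<theta>. \<integral>\<^sup>+ y. log_kernel (shear \<theta> x) (shear \<theta> y) \<partial>\<mu> \<partial>angle_measure \<partial>\<mu>)"
    unfolding energy_density_mixture by (intro nn_integral_cong Fubini') measurable
  also have "\<dots> = (\<integral>\<^sup>+ \<theta>. L \<theta> \<partial>angle_measure)"
    unfolding L by (rule Fubini') measurable
  finally show "energy \<mu> = (\<integral>\<^sup>+ \<theta>. L \<theta> \<partial>angle_measure)" .
qed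

text \<open>
  Links \<^const>\<open>convol\<close>, a difference of two integrals, with the integral of the nonnegative energy density. The identity
  \<open>(V + g) + V\<^sup>- = V\<^sup>+ + g\<close> with \<open>g \<ge> 0\<close> avoids subtraction, and the integral of \<open>V\<^sup>-\<close> is finite.
  The number \<open>1/4\<close> is half of the second moment of the semicircle law.
\<close>

lemma convol_m1:
  "convol V m\<^sub>1 x + ereal ((norm x)\<^sup>2 / 2) + ereal (1 / 4)
    = enn2ereal (\<integral>\<^sup>+ y. e2ennreal (energy_density x y) \<partial>m\<^sub>1)"
proof -
  interpret prob_space "m\<^sub>1" by (rule prob_space_m1)
  define P where "P = (\<integral>\<^sup>+ y. e2ennreal (V (x - y)) \<partial>m\<^sub>1)"
  define N where "N = (\<integral>\<^sup>+ y. e2ennreal (- V (x - y)) \<partial>m\<^sub>1)"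
  define X where "X = (\<integral>\<^sup>+ y. e2ennreal (energy_density x y) \<partial>m\<^sub>1)"
  have N: "N < \<infinity>" unfolding N_def by (rule V_m1_negative_part_finite)
  have [measurable]: "(\<lambda>y. V (x - y)) \<in> borel_measurable borel" by measurable
  have [measurable]: "(norm :: plane \<Rightarrow> real) \<in> borel_measurable borel"
    by (intro borel_measurable_continuous_onI continuous_intros)
  have G: "(\<integral>\<^sup>+ y. ennreal (1 / 2 * ((norm x)\<^sup>2 + (norm y)\<^sup>2)) \<partial>m\<^sub>1) = ennreal ((norm x)\<^sup>2 / 2 + 1 / 4)"
  proof -
    have "(\<integral>\<^sup>+ y. ennreal (1 / 2 * ((norm x)\<^sup>2 + (norm y)\<^sup>2)) \<partial>m\<^sub>1)
        = (\<integral>\<^sup>+ t. ennreal ((norm x)\<^sup>2 / 2) + ennreal (1 / 2) * ennreal (t\<^sup>2) \<partial>semicircle)"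
    proof -
      have "ennreal (1 / 2 * ((norm x)\<^sup>2 + (norm (0 :: real, t))\<^sup>2))
          = ennreal ((norm x)\<^sup>2 / 2 + 1 / 2 * t\<^sup>2)" for t :: real
        by (simp add: norm_Pair add_divide_distrib)
      also have "ennreal ((norm x)\<^sup>2 / 2 + 1 / 2 * t\<^sup>2)
          = ennreal ((norm x)\<^sup>2 / 2) + ennreal (1 / 2) * ennreal (t\<^sup>2)" for t :: real
        by (subst ennreal_plus) (simp_all only: ennreal_mult', simp_all)
      finally show ?thesis by (subst nn_integral_m1) simp_all
    qed
    also have "\<dots> = ennreal ((norm x)\<^sup>2 / 2) + ennreal (1 / 2) * ennreal (1 / 2)"
      using prob_space.emeasure_space_1[OF prob_space_semicircle]
      by (simp add: nn_integral_add nn_integral_cmult semicircle_second_moment)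
    also have "ennreal (1 / 2) * ennreal (1 / 2) = ennreal (1 / 4)"
      by (subst ennreal_mult'[symmetric]) simp_all
    also have "ennreal ((norm x)\<^sup>2 / 2) + ennreal (1 / 4) = ennreal ((norm x)\<^sup>2 / 2 + 1 / 4)"
      by (rule ennreal_plus[symmetric]) simp_all
    finally show ?thesis .
  qed
  have pointwise: "e2ennreal (energy_density x y) + e2ennreal (- V (x - y))
      = e2ennreal (V (x - y)) + ennreal (1 / 2 * ((norm x)\<^sup>2 + (norm y)\<^sup>2))" for y
  proof (cases "x = y")
    case True
    then show ?thesis by (simp add: energy_density_def V_def)
  next
    case False
    then obtain v where v: "V (x - y) = ereal v" by (simp add: V_def)
    define g where "g = 1 / 2 * ((norm x)\<^sup>2 + (norm y)\<^sup>2)"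
    have g: "g \<ge> 0" by (simp add: g_def)
    have "0 \<le> v + g" using energy_density_nonneg[of x y] unfolding energy_density_def v g_def by simp
    then have "ennreal (v + g) + ennreal (- v) = ennreal v + ennreal g"
      using g by (cases "v \<ge> 0") (auto simp: ennreal_neg simp flip: ennreal_plus)
    then show ?thesis unfolding energy_density_def v g_def[symmetric] by simp
  qed
  have "X + N = (\<integral>\<^sup>+ y. e2ennreal (energy_density x y) + e2ennreal (- V (x - y)) \<partial>m\<^sub>1)"
    unfolding X_def N_def by (rule nn_integral_add[symmetric]) measurable
  also have "\<dots> = P + ennreal ((norm x)\<^sup>2 / 2 + 1 / 4)"
    unfolding pointwise P_def G[symmetric] by (rule nn_integral_add) measurable
  finally have eq: "X + N = P + ennreal ((norm x)\<^sup>2 / 2 + 1 / 4)" .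
  obtain n where n: "N = ennreal n" "n \<ge> 0" using N by (cases N) auto
  have c: "convol V m\<^sub>1 x = enn2ereal P - enn2ereal N"
    by (simp add: convol_def ext_integral_def P_def N_def)
  show ?thesis
  proof (cases X)
    case (real r)
    then have "P \<noteq> \<infinity>" using eq n by (auto simp flip: ennreal_plus)
    then obtain p where p: "P = ennreal p" "p \<ge> 0" by (cases P) auto
    have "r + n = p + ((norm x)\<^sup>2 / 2 + 1 / 4)"
      using eq real n p by (simp flip: ennreal_plus)
    then show ?thesis
      unfolding c X_def[symmetric] using real n p by (simp add: enn2ereal_ennreal)
  next
    case top
    with eq have "P = \<infinity>"
      by (metis ennreal_add_eq_top ennreal_neq_top infinity_ennreal_def)
    then show ?thesis
      unfolding c X_def[symmetric] using top n by (simp add: enn2ereal_ennreal)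
  qed
qed

lemma m1_potential_eq:
  "(\<integral>\<^sup>+ y. e2ennreal (energy_density x y) \<partial>m\<^sub>1)
    = (\<integral>\<^sup>+ \<theta>. \<integral>\<^sup>+ t. log_kernel (shear \<theta> x) t \<partial>semicircle \<partial>angle_measure)"
  by (subst potential_mixture[OF prob_space_m1 sets_m1]) (simp add: shear_m1)

lemma m1_potential_ge:
  "ennreal (3 / 4 + ln 2 / 2) \<le> (\<integral>\<^sup>+ y. e2ennreal (energy_density x y) \<partial>m\<^sub>1)"
proof -
  have "ennreal (3 / 4 + ln 2 / 2) = (\<integral>\<^sup>+ \<theta>. ennreal (3 / 4 + ln 2 / 2) \<partial>angle_measure)"
    by (rule nn_integral_angle_const[symmetric])
  also have "\<dots> \<le> (\<integral>\<^sup>+ \<theta>. \<integral>\<^sup>+ t. log_kernel (shear \<theta> x) t \<partial>semicircle \<partial>angle_measure)"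
    by (intro nn_integral_mono semicircle_potential_ge)
  finally show ?thesis by (simp only: m1_potential_eq)
qed

lemma m1_potential_on_axis:
  assumes "\<bar>t\<bar> \<le> sqrt 2"
  shows "(\<integral>\<^sup>+ y. e2ennreal (energy_density (0, t) y) \<partial>m\<^sub>1) = ennreal (3 / 4 + ln 2 / 2)"
proof -
  have "shear \<theta> (0, t) = t" for \<theta> by (simp add: shear_def)
  then show ?thesis
    unfolding m1_potential_eq using semicircle_potential_inside[OF assms] nn_integral_angle_const
    by (simp only:)
qed

lemma supp_m1: "supp m\<^sub>1 \<subseteq> {0} \<times> {- sqrt 2..sqrt 2}"
proof
  fix x assume x: "x \<in> supp m\<^sub>1"
  define U where "U = - ({0 :: real} \<times> {- sqrt 2..sqrt 2})"
  have U: "open U" unfolding U_def by (intro open_Compl closed_Times) auto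
  have "emeasure m\<^sub>1 U = (\<integral>\<^sup>+ t. indicator U (0, t) \<partial>semicircle)"
    using U nn_integral_m1[of "indicator U"] by simp
  also have "\<dots> = (\<integral>\<^sup>+ \<theta>. indicator U (0 :: real, - (sqrt 2 * cos \<theta>)) \<partial>angle_measure)"
    using U by (intro nn_integral_semicircle measurable_compose[OF axis_measurable]
        borel_measurable_indicator) auto
  also have "\<dots> = (\<integral>\<^sup>+ \<theta>. 0 \<partial>angle_measure)"
  proof (rule nn_integral_cong)
    fix \<theta> :: real
    have "\<bar>- (sqrt 2 * cos \<theta>)\<bar> \<le> sqrt 2" by (simp add: abs_mult mult_left_le)
    then show "indicator U (0 :: real, - (sqrt 2 * cos \<theta>)) = (0 :: ennreal)"
      by (auto simp: U_def indicator_def)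
  qed
  finally have "emeasure m\<^sub>1 U = 0" by simp
  then have "x \<notin> U" using x U by (auto simp: supp_def)
  then show "x \<in> {0} \<times> {- sqrt 2..sqrt 2}" by (simp add: U_def)
qed

lemma AE_eq_of_nn_integral_le:
  assumes "prob_space M" and [measurable]: "f \<in> borel_measurable M"
    and ge: "\<And>x. x \<in> space M \<Longrightarrow> ennreal c \<le> f x" and le: "(\<integral>\<^sup>+ x. f x \<partial>M) \<le> ennreal c"
  shows "AE x in M. f x = ennreal c"
proof -
  interpret prob_space M by fact
  have "(\<integral>\<^sup>+ x. f x - ennreal c \<partial>M) = (\<integral>\<^sup>+ x. f x \<partial>M) - (\<integral>\<^sup>+ x. ennreal c \<partial>M)"
    by (rule nn_integral_diff) (auto simp: emeasure_space_1 intro!: AE_I2 ge)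
  also have "\<dots> = 0" using le by (simp add: emeasure_space_1 diff_eq_0_iff_ennreal order_le_less_trans)
  finally have "AE x in M. f x - ennreal c = 0"
    by (subst (asm) nn_integral_0_iff_AE) auto
  with AE_space show ?thesis
  proof eventually_elim
    case (elim x)
    then have "f x \<le> ennreal c" by (auto simp: diff_eq_0_iff_ennreal)
    with elim ge[of x] show ?case by (intro antisym) auto
  qed
qed

lemma energy_ge:
  fixes \<mu> :: "plane measure"
  assumes \<mu>: "prob_space \<mu>" "sets \<mu> = sets borel"
  shows "ennreal (3 / 4 + ln 2 / 2) \<le> energy \<mu>"
    and "energy \<mu> \<le> ennreal (3 / 4 + ln 2 / 2) \<Longrightarrow>
      AE \<theta> in lborel. \<theta> \<in> {0<..<pi} \<longrightarrow> distr \<mu> borel (shear \<theta>) = semicircle"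
proof -
  interpret \<mu>: prob_space \<mu> by fact
  note [measurable_cong] = \<mu>(2)
  define D where "D \<theta> = distr \<mu> borel (shear \<theta>)" for \<theta>
  define L where "L \<theta> = log_energy (D \<theta>) (D \<theta>)" for \<theta>
  note en = energy_mixture[OF \<mu>, folded D_def, folded L_def]
  let ?e = "ennreal (3 / 4 + ln 2 / 2)"
  have D: "prob_space (D \<theta>)" "sets (D \<theta>) = sets borel" for \<theta>
    unfolding D_def by (rule \<mu>.prob_space_distr) simp_all
  note ge = log_energy_ge[OF D, folded L_def]
  have L: "?e \<le> L \<theta>" for \<theta>
    by (rule order_trans[OF _ ge]) simp
  have "?e = (\<integral>\<^sup>+ \<theta>. ?e \<partial>angle_measure)" by (rule nn_integral_angle_const[symmetric])
  also have "\<dots> \<le> energy \<mu>" unfolding en(2) by (intro nn_integral_mono L)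
  finally show "?e \<le> energy \<mu>" .
  assume "energy \<mu> \<le> ?e"
  then have AE: "AE \<theta> in angle_measure. L \<theta> = ?e"
    unfolding en(2) using en(1) L by (intro AE_eq_of_nn_integral_le prob_space_angle) auto
  have eq: "D \<theta> = semicircle" if "L \<theta> = ?e" for \<theta>
  proof -
    have "window_distance (D \<theta>) semicircle + ?e \<le> 0 + ?e" using ge[of \<theta>] that by simp
    then have "window_distance (D \<theta>) semicircle = 0"
      by (subst (asm) (1 2) add.commute, subst (asm) ennreal_add_left_cancel_le) auto
    then show ?thesis
      by (intro window_distance_zero_imp_eq D prob_space_semicircle sets_semicircle)
  qed
  from AE have "AE \<theta> in angle_measure. D \<theta> = semicircle" by eventually_elim (rule eq)
  then show "AE \<theta> in lborel. \<theta> \<in> {0<..<pi} \<longrightarrow> distr \<mu> borel (shear \<theta>) = semicircle"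
    unfolding AE_angle D_def .
qed

lemma energy_m1: "energy m\<^sub>1 = ennreal (3 / 4 + ln 2 / 2)"
  using energy_mixture(2)[OF prob_space_m1 sets_m1]
  by (simp add: shear_m1 log_energy_semicircle prob_space.emeasure_space_1[OF prob_space_angle])

lemma AE_semicircle_bounded: "AE t in semicircle. \<bar>t\<bar> \<le> sqrt 2"
  unfolding semicircle_def by (subst AE_density) (auto simp: indicator_def)

text \<open>
  Along angles with \<open>cot \<theta> \<ge> n\<close> the projections stay in \<open>[-\<surd>2, \<surd>2]\<close>, so \<open>n |x\<^sub>1| \<le> \<surd>2 + |x\<^sub>2|\<close>
  almost surely for every \<open>n\<close>, and \<open>x\<^sub>1 = 0\<close>. On the axis, \<open>x\<close> is recovered from any one of its projections.
\<close>

lemma eq_m1_if_shears_semicircle: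
  fixes \<mu> :: "plane measure"
  assumes \<mu>: "prob_space \<mu>" "sets \<mu> = sets borel"
    and AE: "AE \<theta> in lborel. \<theta> \<in> {0<..<pi} \<longrightarrow> distr \<mu> borel (shear \<theta>) = semicircle"
  shows "\<mu> = m\<^sub>1"
proof -
  interpret \<mu>: prob_space \<mu> by fact
  note [measurable_cong] = \<mu>(2)
  have "\<exists>\<theta>. sin \<theta> > 0 \<and> real n * sin \<theta> \<le> cos \<theta> \<and> distr \<mu> borel (shear \<theta>) = semicircle" for n :: nat
  proof -
    have "((\<lambda>\<theta>. cos \<theta> - real n * sin \<theta>) \<longlongrightarrow> cos 0 - real n * sin 0) (at_right 0)"
      by (intro tendsto_intros)
    then have "eventually (\<lambda>\<theta>. cos \<theta> - real n * sin \<theta> > 0) (at_right 0)"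
      by (rule order_tendstoD) simp
    then obtain b where b: "b > 0" "\<And>\<theta>. 0 < \<theta> \<Longrightarrow> \<theta> < b \<Longrightarrow> cos \<theta> - real n * sin \<theta> > 0"
      by (auto simp: eventually_at_right_field)
    obtain \<theta> where \<theta>: "0 < \<theta>" "\<theta> < min b pi" "\<theta> \<in> {0<..<pi} \<longrightarrow> distr \<mu> borel (shear \<theta>) = semicircle"
      using AE_lborel_interval[OF AE, of 0 "min b pi"] b(1) by auto
    then show ?thesis using b(2)[of \<theta>] sin_gt_zero[of \<theta>] by (intro exI[of _ \<theta>]) auto
  qed
  then obtain \<theta> where \<theta>: "\<And>n. sin (\<theta> n) > 0" "\<And>n. real n * sin (\<theta> n) \<le> cos (\<theta> n)"
    "\<And>n. distr \<mu> borel (shear (\<theta> n)) = semicircle"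
    by metis
  have "AE x in \<mu>. \<bar>shear (\<theta> n) x\<bar> \<le> sqrt 2" for n
  proof -
    have "AE t in distr \<mu> borel (shear (\<theta> n)). \<bar>t\<bar> \<le> sqrt 2"
      unfolding \<theta>(3) by (rule AE_semicircle_bounded)
    then show ?thesis by (subst (asm) AE_distr_iff) auto
  qed
  then have "AE x in \<mu>. \<forall>n. \<bar>shear (\<theta> n) x\<bar> \<le> sqrt 2" by (simp add: AE_all_countable)
  then have axis: "AE x in \<mu>. x = (0, shear (\<theta> 0) x)"
  proof eventually_elim
    case (elim x)
    have "real n * \<bar>fst x\<bar> \<le> sqrt 2 + \<bar>snd x\<bar>" for n
    proof -
      have "real n \<le> cos (\<theta> n) / sin (\<theta> n)" using \<theta>(1,2)[of n] by (simp add: field_simps)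
      then have "real n * \<bar>fst x\<bar> \<le> \<bar>fst x * (cos (\<theta> n) / sin (\<theta> n))\<bar>"
        by (subst abs_mult) (metis abs_ge_self abs_ge_zero mult.commute mult_right_mono order_trans)
      also have "\<dots> \<le> \<bar>shear (\<theta> n) x\<bar> + \<bar>snd x\<bar>" unfolding shear_def by linarith
      finally show ?thesis using elim[rule_format, of n] by linarith
    qed
    then have "fst x = 0"
      by (metis abs_eq_0 abs_ge_zero ex_less_of_nat_mult linorder_not_le order_le_less)
    then show ?case by (simp add: shear_def prod_eq_iff)
  qed
  have "\<mu> = distr \<mu> borel (\<lambda>x. x)" using \<mu>(2) by (simp add: distr_id2)
  also have "\<dots> = distr \<mu> borel (\<lambda>x. (0, shear (\<theta> 0) x))"
    using axis by (intro distr_cong_AE) auto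
  also have "\<dots> = distr (distr \<mu> borel (shear (\<theta> 0))) borel (\<lambda>t. (0, t))"
    by (subst distr_distr) (auto simp: o_def)
  also have "\<dots> = m\<^sub>1" unfolding \<theta>(3) m1_distr ..
  finally show ?thesis .
qed

theorem theorem1p2:
  shows "(\<forall>x \<in> supp m\<^sub>1.
            convol V m\<^sub>1 x + ereal ((norm x)\<^sup>2 / 2) = ereal (1 / 2 + 1 / 2 * ln 2))
       \<and> (\<forall>x.
            convol V m\<^sub>1 x + ereal ((norm x)\<^sup>2 / 2) \<ge> ereal (1 / 2 + 1 / 2 * ln 2))
       \<and> (\<forall>\<mu>. is_arg_min energy (\<lambda>\<nu>. \<nu> \<in> prob_measures) \<mu> \<longleftrightarrow> \<mu> = m\<^sub>1)"
proof (intro conjI ballI allI)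
  fix x assume "x \<in> supp m\<^sub>1"
  then have "x \<in> {0} \<times> {- sqrt 2..sqrt 2}" using supp_m1 by blast
  then obtain t where t: "x = (0, t)" "\<bar>t\<bar> \<le> sqrt 2" by auto
  have "convol V m\<^sub>1 x + ereal ((norm x)\<^sup>2 / 2) + ereal (1 / 4) = ereal (3 / 4 + ln 2 / 2)"
    unfolding convol_m1 unfolding t(1) m1_potential_on_axis[OF t(2)] by (rule enn2ereal_ennreal) simp
  then show "convol V m\<^sub>1 x + ereal ((norm x)\<^sup>2 / 2) = ereal (1 / 2 + 1 / 2 * ln 2)"
    by (cases "convol V m\<^sub>1 x + ereal ((norm x)\<^sup>2 / 2)") auto
next
  fix x
  have "ereal (3 / 4 + ln 2 / 2) = enn2ereal (ennreal (3 / 4 + ln 2 / 2))" by (rule enn2ereal_ennreal[symmetric]) simp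
  also have "\<dots> \<le> convol V m\<^sub>1 x + ereal ((norm x)\<^sup>2 / 2) + ereal (1 / 4)"
    unfolding convol_m1 by (subst less_eq_ennreal.rep_eq[symmetric]) (rule m1_potential_ge)
  finally show "convol V m\<^sub>1 x + ereal ((norm x)\<^sup>2 / 2) \<ge> ereal (1 / 2 + 1 / 2 * ln 2)"
    by (cases "convol V m\<^sub>1 x + ereal ((norm x)\<^sup>2 / 2)") auto
next
  fix \<mu> :: "plane measure"
  have P: "\<nu> \<in> prob_measures \<longleftrightarrow> prob_space \<nu> \<and> sets \<nu> = sets borel" for \<nu>
    by (auto simp: prob_measures_def space_prob_algebra)
  show "is_arg_min energy (\<lambda>\<nu>. \<nu> \<in> prob_measures) \<mu> \<longleftrightarrow> \<mu> = m\<^sub>1"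
  proof
    assume "is_arg_min energy (\<lambda>\<nu>. \<nu> \<in> prob_measures) \<mu>"
    then have \<mu>: "prob_space \<mu>" "sets \<mu> = sets borel" and "\<not> energy m\<^sub>1 < energy \<mu>"
      using prob_space_m1 sets_m1 by (auto simp: is_arg_min_def P)
    then have "energy \<mu> \<le> ennreal (3 / 4 + ln 2 / 2)" by (simp add: energy_m1)
    from eq_m1_if_shears_semicircle[OF \<mu> energy_ge(2)[OF \<mu> this]] show "\<mu> = m\<^sub>1" .
  next
    assume "\<mu> = m\<^sub>1"
    then show "is_arg_min energy (\<lambda>\<nu>. \<nu> \<in> prob_measures) \<mu>"
      using prob_space_m1 sets_m1 energy_ge(1) by (auto simp: is_arg_min_def P energy_m1 not_less)
  qed
qed

end
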